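(* Let $(W,S)$ be a finite Coxeter system and let $I\subsetneq S$. Then $W/W_I$ strongly percolates if and only if $|I|=|S|-1$.
   Context: A finite Coxeter system $(W,S)$: $W$ is a finite group with generating set $S=\{s_1,\dots,s_m\}$ and presentation $\langle s_1,\dots,s_m \mid (s_is_j)^{m_{ij}}=1\rangle$, $m_{ii}=1$, $m_{ij}=m_{ji}\ge2$ for $i\ne j$. $\ell(w)$ is the length of $w$ with respect to $S$; $T=\{usu^{-1}:s\in S,u\in W\}$ is the set of reflections. For $I\subseteq S$, $W_I$ is the subgroup generated by $I$ and $w^I$ is the unique minimum-length element of the left coset $wW_I$. For $t\in T$: $L^I_t=\{wW_I:\ell((tw)^I)>\ell(w^I)\}$, $R^I_t=\{wW_I:\ell((tw)^I)<\ell(w^I)\}$, $F^I_t=\{wW_I:\ell((tw)^I)=\ell(w^I)\}$; the left-folding map is $t^+(wW_I)=twW_I$ if $wW_I\in R^I_t$ and $wW_I$ otherwise; the right-folding map is $t^-(wW_I)=twW_I$ if $wW_I\in L^I_t$ and $wW_I$ otherwise; for $X\subseteq W/W_I$, $X^\pm(t)=\{wW_I:t^\pm(wW_I)\in X\}$. A strong folding sequence is a sequence $J_0,J_1,\dots$ of subsets of $W/W_I$ such that for each $i$ there is $t_i\in T$ with $J_{i+1}=J_i^+(t_i)$ or $J_{i+1}=J_i^-(t_i)$, and $J_i$ meets both $L^I_{t_i}\cup F^I_{t_i}$ and $R^I_{t_i}\cup F^I_{t_i}$. A strong percolating sequence is a finite strong folding sequence starting from a pair $\{W_I,wW_I\}$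 and ending with $W/W_I$. $W/W_I$ strongly percolates if for every $w\in W\setminus W_I$ there is a strong percolating sequence starting from $\{W_I,wW_I\}$. *)

theory Defs
  imports "HOL-Algebra.Algebra"
begin

section \<open>Group presentations\<close>

text \<open>
  A word over \<open>S\<close> is a list of signed letters: \<open>(s, True)\<close> stands for \<open>s\<close> and \<open>(s, False)\<close> for
  the formal inverse of \<open>s\<close>. The relation \<open>presented_eq S R\<close> is equality in the group
  \<open>\<langle>S | R\<rangle>\<close>: the least equivalence relation on words under which inverse pairs and relators
  may be inserted and deleted anywhere.
\<close>

type_synonym 'a word = "('a \<times> bool) list"

abbreviation words :: "'a set \<Rightarrow> 'a word set" where
  "words S \<equiv> lists (S \<times> UNIV)"

inductive presented_eq :: "'a set \<Rightarrow> 'a word set \<Rightarrow> 'a word \<Rightarrow> 'a word \<Rightarrow> bool"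
  for S :: "'a set" and R :: "'a word set" where
  refl: "w \<in> words S \<Longrightarrow> presented_eq S R w w"
| sym: "presented_eq S R v w \<Longrightarrow> presented_eq S R w v"
| trans: "presented_eq S R u v \<Longrightarrow> presented_eq S R v w \<Longrightarrow> presented_eq S R u w"
| cancel: "u \<in> words S \<Longrightarrow> v \<in> words S \<Longrightarrow> s \<in> S
    \<Longrightarrow> presented_eq S R (u @ [(s, b), (s, \<not> b)] @ v) (u @ v)"
| relator: "u \<in> words S \<Longrightarrow> v \<in> words S \<Longrightarrow> r \<in> R
    \<Longrightarrow> presented_eq S R (u @ r @ v) (u @ v)"

definition word_eval :: "('a, 'b) monoid_scheme \<Rightarrow> 'a word \<Rightarrow> 'a" where
  "word_eval G w =
     foldr (\<lambda>(s, b) x. (if b then s else inv\<^bsub>G\<^esub> s) \<otimes>\<^bsub>G\<^esub> x) w \<one>\<^bsub>G\<^esub>"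

text \<open>
  Evaluation of words induces an isomorphism from \<open>\<langle>S | R\<rangle>\<close> onto \<open>G\<close>: the conjunct on
  \<open>generate\<close> is surjectivity, the last one well-definedness and injectivity.
\<close>

definition presented_by :: "('a, 'b) monoid_scheme \<Rightarrow> 'a set \<Rightarrow> 'a word set \<Rightarrow> bool" where
  "presented_by G S R \<longleftrightarrow>
     S \<subseteq> carrier G \<and> generate G S = carrier G \<and> R \<subseteq> words S \<and>
     (\<forall>v\<in>words S. \<forall>w\<in>words S. word_eval G v = word_eval G w \<longleftrightarrow> presented_eq S R v w)"

section \<open>Finite Coxeter systems\<close>

definition coxeter_relators :: "'a set \<Rightarrow> ('a \<Rightarrow> 'a \<Rightarrow> nat) \<Rightarrow> 'a word set" where
  "coxeter_relators S m =
     {concat (replicate (m s t) [(s, True), (t, True)]) | s t. s \<in> S \<and> t \<in> S}"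

locale finite_coxeter_system = group G
  for G :: "('a, 'b) monoid_scheme" (structure) +
  fixes S :: "'a set" and m :: "'a \<Rightarrow> 'a \<Rightarrow> nat"
  assumes finite_carrier: "finite (carrier G)"
    and m_diag: "s \<in> S \<Longrightarrow> m s s = 1"
    and m_sym: "s \<in> S \<Longrightarrow> t \<in> S \<Longrightarrow> m s t = m t s"
    and m_ge_2: "s \<in> S \<Longrightarrow> t \<in> S \<Longrightarrow> s \<noteq> t \<Longrightarrow> 2 \<le> m s t"
    and presented: "presented_by G S (coxeter_relators S m)"

text \<open>
  In a Coxeter system the generators are involutions, so words without inverse letters
  suffice for the length.
\<close>

definition coxeter_length :: "('a, 'b) monoid_scheme \<Rightarrow> 'a set \<Rightarrow> 'a \<Rightarrow> nat" where
  "coxeter_length G S w =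
     (LEAST n. \<exists>ss\<in>lists S. length ss = n \<and> foldr (\<otimes>\<^bsub>G\<^esub>) ss \<one>\<^bsub>G\<^esub> = w)"

definition reflections :: "('a, 'b) monoid_scheme \<Rightarrow> 'a set \<Rightarrow> 'a set" where
  "reflections G S = {u \<otimes>\<^bsub>G\<^esub> s \<otimes>\<^bsub>G\<^esub> inv\<^bsub>G\<^esub> u | u s. u \<in> carrier G \<and> s \<in> S}"

definition min_rep :: "('a, 'b) monoid_scheme \<Rightarrow> 'a set \<Rightarrow> 'a set \<Rightarrow> 'a \<Rightarrow> 'a" where
  "min_rep G S I w =
     (THE v. is_arg_min (coxeter_length G S) (\<lambda>v. v \<in> w <#\<^bsub>G\<^esub> generate G I) v)"

section \<open>Foldings and percolation\<close>

definition left_cosets_of ::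
  "('a, 'b) monoid_scheme \<Rightarrow> 'a set \<Rightarrow> 'a set \<Rightarrow> 'a \<Rightarrow> 'a set set" where
  "left_cosets_of G S I t =
     {w <#\<^bsub>G\<^esub> generate G I | w. w \<in> carrier G \<and>
        coxeter_length G S (min_rep G S I (t \<otimes>\<^bsub>G\<^esub> w)) > coxeter_length G S (min_rep G S I w)}"

definition right_cosets_of ::
  "('a, 'b) monoid_scheme \<Rightarrow> 'a set \<Rightarrow> 'a set \<Rightarrow> 'a \<Rightarrow> 'a set set" where
  "right_cosets_of G S I t =
     {w <#\<^bsub>G\<^esub> generate G I | w. w \<in> carrier G \<and>
        coxeter_length G S (min_rep G S I (t \<otimes>\<^bsub>G\<^esub> w)) < coxeter_length G S (min_rep G S I w)}"

definition fixed_cosets_of ::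
  "('a, 'b) monoid_scheme \<Rightarrow> 'a set \<Rightarrow> 'a set \<Rightarrow> 'a \<Rightarrow> 'a set set" where
  "fixed_cosets_of G S I t =
     {w <#\<^bsub>G\<^esub> generate G I | w. w \<in> carrier G \<and>
        coxeter_length G S (min_rep G S I (t \<otimes>\<^bsub>G\<^esub> w)) = coxeter_length G S (min_rep G S I w)}"

text \<open>\<open>t <# C\<close> is the coset \<open>twW\<^sub>I\<close> when \<open>C = wW\<^sub>I\<close>. The left folding moves the right cosets.\<close>

definition left_folding ::
  "('a, 'b) monoid_scheme \<Rightarrow> 'a set \<Rightarrow> 'a set \<Rightarrow> 'a \<Rightarrow> 'a set \<Rightarrow> 'a set" where
  "left_folding G S I t C = (if C \<in> right_cosets_of G S I t then t <#\<^bsub>G\<^esub> C else C)"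

definition right_folding ::
  "('a, 'b) monoid_scheme \<Rightarrow> 'a set \<Rightarrow> 'a set \<Rightarrow> 'a \<Rightarrow> 'a set \<Rightarrow> 'a set" where
  "right_folding G S I t C = (if C \<in> left_cosets_of G S I t then t <#\<^bsub>G\<^esub> C else C)"

text \<open>The folded sets \<open>Y\<^sup>+(t)\<close> and \<open>Y\<^sup>-(t)\<close> are preimages of \<open>Y\<close>, not images.\<close>

definition left_fold_set ::
  "('a, 'b) monoid_scheme \<Rightarrow> 'a set \<Rightarrow> 'a set \<Rightarrow> 'a \<Rightarrow> 'a set set \<Rightarrow> 'a set set" where
  "left_fold_set G S I t Y = {C \<in> lcosets\<^bsub>G\<^esub> (generate G I). left_folding G S I t C \<in> Y}"

definition right_fold_set ::
  "('a, 'b) monoid_scheme \<Rightarrow> 'a set \<Rightarrow> 'a set \<Rightarrow> 'a \<Rightarrow> 'a set set \<Rightarrow> 'a set set" where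
  "right_fold_set G S I t Y = {C \<in> lcosets\<^bsub>G\<^esub> (generate G I). right_folding G S I t C \<in> Y}"

definition strong_folding_step ::
  "('a, 'b) monoid_scheme \<Rightarrow> 'a set \<Rightarrow> 'a set \<Rightarrow> 'a set set \<Rightarrow> 'a set set \<Rightarrow> bool" where
  "strong_folding_step G S I J J' \<longleftrightarrow>
     (\<exists>t\<in>reflections G S.
        (J' = left_fold_set G S I t J \<or> J' = right_fold_set G S I t J) \<and>
        J \<inter> (left_cosets_of G S I t \<union> fixed_cosets_of G S I t) \<noteq> {} \<and>
        J \<inter> (right_cosets_of G S I t \<union> fixed_cosets_of G S I t) \<noteq> {})"

definition finite_strong_folding_sequence ::
  "('a, 'b) monoid_scheme \<Rightarrow> 'a set \<Rightarrow> 'a set \<Rightarrow> 'a set set list \<Rightarrow> bool" where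
  "finite_strong_folding_sequence G S I Js \<longleftrightarrow>
     Js \<noteq> [] \<and> (\<forall>J\<in>set Js. J \<subseteq> lcosets\<^bsub>G\<^esub> (generate G I)) \<and>
     (\<forall>i. Suc i < length Js \<longrightarrow> strong_folding_step G S I (Js ! i) (Js ! Suc i))"

definition strong_percolating_sequence ::
  "('a, 'b) monoid_scheme \<Rightarrow> 'a set \<Rightarrow> 'a set \<Rightarrow> 'a \<Rightarrow> 'a set set list \<Rightarrow> bool" where
  "strong_percolating_sequence G S I w Js \<longleftrightarrow>
     finite_strong_folding_sequence G S I Js \<and>
     hd Js = {generate G I, w <#\<^bsub>G\<^esub> generate G I} \<and>
     last Js = lcosets\<^bsub>G\<^esub> (generate G I)"

definition strongly_percolates ::
  "('a, 'b) monoid_scheme \<Rightarrow> 'a set \<Rightarrow> 'a set \<Rightarrow> bool" where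
  "strongly_percolates G S I \<longleftrightarrow>
     (\<forall>w \<in> carrier G - generate G I. \<exists>Js. strong_percolating_sequence G S I w Js)"

end

theory Submission
  imports Defs "HOL-Library.Sublist"
begin

text \<open>
  The parity of the number of times \<open>x\<close> occurs among the reflections met along a word depends only
  on the group element, because it is unchanged by cancellations and Coxeter relators. This gives
  strong exchange and shows that a coset \<open>wW\<^sub>I\<close> is fixed by \<open>t\<close> if \<open>w\<inverse>tw\<close> lies in \<open>W\<^sub>I\<close>, and
  otherwise lies on the right side exactly if \<open>t\<close> is an inversion of \<open>w\<close>.

  If \<open>S\<close> has two elements \<open>s\<close>, \<open>s'\<close> outside \<open>I\<close>, let \<open>K = I \<union> {s}\<close>. A reflection outside \<open>W\<^sub>K\<close>
  has all of \<open>W\<^sub>K\<close> strictly on one side, so strong foldings starting from \<open>{W\<^sub>I, sW\<^sub>I}\<close> never leave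
  \<open>W\<^sub>K\<close>.

  If \<open>S - I = {s}\<close>, one strong folding takes \<open>{W\<^sub>I, wW\<^sub>I}\<close> to a translate of \<open>{W\<^sub>I, sW\<^sub>I}\<close>. Strong
  foldings commute with translation, and from \<open>{W\<^sub>I, sW\<^sub>I}\<close> left foldings along simple reflections
  produce growing lower sets of the Bruhat order until everything is covered.
\<close>

section \<open>Inversions\<close>

context group
begin

definition list_prod :: "'a list \<Rightarrow> 'a" where
  "list_prod ss = foldr (\<otimes>) ss \<one>"

lemma list_prod_simps [simp]:
  "list_prod [] = \<one>"
  "list_prod (s # ss) = s \<otimes> list_prod ss"
  by (simp_all add: list_prod_def)

abbreviation conj_by :: "'a \<Rightarrow> 'a \<Rightarrow> 'a" where
  "conj_by g x \<equiv> inv g \<otimes> x \<otimes> g"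

text \<open>For a word \<open>s_1 ... s_n\<close> this is the parity of the number of
  \<open>i\<close> with \<open>x = p s_i p^-1\<close>, where \<open>p = s_1 ... s_(i-1)\<close>.
  Peeling off the first letter conjugates all later tests by it, so no prefix has to be carried
  along.\<close>

primrec inversion_parity :: "'a list \<Rightarrow> 'a \<Rightarrow> bool" where
  "inversion_parity [] x \<longleftrightarrow> False"
| "inversion_parity (s # ss) x \<longleftrightarrow> (x = s) \<noteq> inversion_parity ss (conj_by s x)"

lemma list_prod_closed [simp]:
  "ss \<in> lists (carrier G) \<Longrightarrow> list_prod ss \<in> carrier G"
  by (induction ss) auto

lemma list_prod_append:
  "us \<in> lists (carrier G) \<Longrightarrow> vs \<in> lists (carrier G)
    \<Longrightarrow> list_prod (us @ vs) = list_prod us \<otimes> list_prod vs"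
  by (induction us) (auto simp: m_assoc)

lemma inv_mult_cancel [simp]:
  "x \<in> carrier G \<Longrightarrow> y \<in> carrier G \<Longrightarrow> inv x \<otimes> (x \<otimes> y) = y"
  "x \<in> carrier G \<Longrightarrow> y \<in> carrier G \<Longrightarrow> x \<otimes> (inv x \<otimes> y) = y"
  by (simp_all flip: m_assoc)

lemma conj_by_mult:
  "g \<in> carrier G \<Longrightarrow> h \<in> carrier G \<Longrightarrow> x \<in> carrier G
    \<Longrightarrow> conj_by (g \<otimes> h) x = conj_by h (conj_by g x)"
  by (simp add: inv_mult_group m_assoc)

text \<open>Prefixes reaching into \<open>vs\<close> start with the product of \<open>us\<close>.
  This cocycle identity becomes \<open>inverts_mult\<close> on group elements.\<close>

lemma inversion_parity_append:
  "us \<in> lists (carrier G) \<Longrightarrow> vs \<in> lists (carrier G) \<Longrightarrow> x \<in> carrier G \<Longrightarrow>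
    inversion_parity (us @ vs) x \<longleftrightarrow>
      inversion_parity us x \<noteq> inversion_parity vs (conj_by (list_prod us) x)"
proof (induction us arbitrary: x)
  case (Cons s us)
  then show ?case
    by (auto simp: conj_by_mult)
qed auto

text \<open>Conjugation by \<open>s\<close> fixes \<open>s\<close>, so both copies of
  \<open>s\<close> test \<open>x = s\<close> and cancel; the remaining letters are tested after
  conjugation by \<open>s \<otimes> s = \<one>\<close>.\<close>

lemma inversion_parity_involution:
  assumes s: "s \<in> carrier G" "s \<otimes> s = \<one>" and x: "x \<in> carrier G"
  shows "inversion_parity (s # s # ss) x \<longleftrightarrow> inversion_parity ss x"
proof -
  have "conj_by s (conj_by s x) = conj_by (s \<otimes> s) x"
    using s(1) x by (simp only: conj_by_mult)
  then have cc: "conj_by s (conj_by s x) = x"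
    using x by (simp add: s(2))
  have "conj_by s x = s \<longleftrightarrow> x = s"
  proof
    assume "conj_by s x = s"
    with cc have "conj_by s s = x" by simp
    with s show "x = s" by (simp add: m_assoc)
  qed (use s in \<open>simp add: m_assoc\<close>)
  with cc show ?thesis by auto
qed

text \<open>An odd count is nonzero, so \<open>x\<close> is the conjugate belonging to some letter;
  the induction undoes the conjugation by the letters peeled off.\<close>

lemma inversion_parity_delete:
  assumes "ss \<in> lists (carrier G)" "x \<in> carrier G" "inversion_parity ss x"
  obtains us s vs where "ss = us @ s # vs"
    "x = list_prod us \<otimes> s \<otimes> inv (list_prod us)"
proof -
  have "\<exists>us s vs. ss = us @ s # vs \<and> x = list_prod us \<otimes> s \<otimes> inv (list_prod us)"
    using assms
  proof (induction ss arbitrary: x rule: list.induct)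
    case (Cons s ss)
    show ?case
    proof (cases "x = s")
      case True
      with Cons.prems have "x = list_prod [] \<otimes> s \<otimes> inv (list_prod [])" by auto
      then show ?thesis by blast
    next
      case False
      have sc: "s \<in> carrier G" and ssc: "ss \<in> lists (carrier G)"
        using Cons.prems(1) by auto
      have "inversion_parity ss (conj_by s x)"
        using Cons.prems False by auto
      with Cons.IH[of "conj_by s x"] sc ssc Cons.prems obtain us r vs where
        ss: "ss = us @ r # vs" and e: "conj_by s x = list_prod us \<otimes> r \<otimes> inv (list_prod us)"
        by auto
      have uc: "list_prod us \<in> carrier G" "r \<in> carrier G"
        using ss ssc by auto
      have "x = s \<otimes> conj_by s x \<otimes> inv s"
        using sc Cons.prems by (simp add: m_assoc)
      also have "\<dots> = list_prod (s # us) \<otimes> r \<otimes> inv (list_prod (s # us))"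
        using sc uc e by (simp add: m_assoc inv_mult_group)
      finally have "x = list_prod (s # us) \<otimes> r \<otimes> inv (list_prod (s # us))" .
      with ss show ?thesis by (metis append_Cons)
    qed
  qed auto
  then show thesis using that by blast
qed

lemma list_prod_delete:
  assumes "us \<in> lists (carrier G)" "s \<in> carrier G" "vs \<in> lists (carrier G)" "s \<otimes> s = \<one>"
  shows "list_prod us \<otimes> s \<otimes> inv (list_prod us) \<otimes> list_prod (us @ s # vs) = list_prod (us @ vs)"
proof -
  have "s \<otimes> (s \<otimes> list_prod vs) = list_prod vs"
    using assms by (simp flip: m_assoc)
  then show ?thesis
    using assms by (simp add: list_prod_append m_assoc)
qed

text \<open>The reflections met along the word \<open>stst\<dots>\<close> of length \<open>2k\<close> are \<open>(st)\<^sup>is\<close> for \<open>i < 2k\<close>.\<close>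

lemma inversion_parity_alternating:
  assumes s: "s \<in> carrier G" "s \<otimes> s = \<one>" and t: "t \<in> carrier G" "t \<otimes> t = \<one>"
    and x: "x \<in> carrier G"
  shows "inversion_parity (concat (replicate k [s, t])) x \<longleftrightarrow>
    odd (\<Sum>i<2*k. of_bool (x = (s \<otimes> t) [^] i \<otimes> s) :: nat)"
  using x
proof (induction k arbitrary: x)
  case (Suc k)
  have ginv: "inv s = s" "inv t = t"
    using s t by (auto intro: inv_equality)
  let ?p = "s \<otimes> t"
  let ?y = "conj_by t (conj_by s x)"
  have p: "?p \<in> carrier G" using s t by auto
  have pinv: "t \<otimes> s = inv ?p" using s t ginv by (simp add: inv_mult_group)
  \<comment> \<open>The dihedral relation: conjugation by \<open>s\<close> inverts
    \<open>st\<close>, since \<open>ts = (st)^-1\<close>.\<close>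
  have sp: "?p [^] i \<otimes> s = s \<otimes> inv ?p [^] i" for i :: nat
  proof (induction i)
    case (Suc i)
    have "?p [^] Suc i \<otimes> s = ?p [^] i \<otimes> s \<otimes> (t \<otimes> s)"
      using s t by (simp add: m_assoc)
    also have "\<dots> = s \<otimes> inv ?p [^] i \<otimes> inv ?p"
      using Suc pinv by simp
    finally show ?case
      using s t by (simp add: m_assoc)
  qed (use s in auto)
  \<comment> \<open>As \<open>s (st)^-1 = (st) s\<close>, conjugating \<open>(st)^i s\<close> by
    \<open>st\<close> gives \<open>(st)^(i+2) s\<close>. So passing two letters shifts the exponent
    by two, and the exponents 0 and 1 belong to these two letters themselves.\<close>
  have shift: "?y = ?p [^] i \<otimes> s \<longleftrightarrow> x = ?p [^] Suc (Suc i) \<otimes> s" for i :: nat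
  proof -
    have y: "?y = inv ?p \<otimes> x \<otimes> ?p"
      using s t Suc.prems by (simp add: inv_mult_group m_assoc)
    have q: "?p [^] i \<otimes> s \<in> carrier G" using s t by auto
    have "?y = ?p [^] i \<otimes> s \<longleftrightarrow> x = ?p \<otimes> (?p [^] i \<otimes> s) \<otimes> inv ?p"
    proof
      assume q': "?y = ?p [^] i \<otimes> s"
      have "x = ?p \<otimes> (inv ?p \<otimes> x \<otimes> ?p) \<otimes> inv ?p"
        using Suc.prems p by (simp only: m_assoc inv_mult_cancel m_closed inv_closed r_inv r_one)
      then show "x = ?p \<otimes> (?p [^] i \<otimes> s) \<otimes> inv ?p"
        unfolding q'[symmetric] y .
    next
      assume "x = ?p \<otimes> (?p [^] i \<otimes> s) \<otimes> inv ?p"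
      then show "?y = ?p [^] i \<otimes> s"
        using Suc.prems p q unfolding y by (simp add: m_assoc)
    qed
    moreover have "?p \<otimes> (?p [^] i \<otimes> s) \<otimes> inv ?p = ?p [^] Suc (Suc i) \<otimes> s"
    proof -
      have "?p \<otimes> (?p [^] i \<otimes> s) \<otimes> inv ?p = ?p \<otimes> (?p [^] i \<otimes> s \<otimes> inv ?p)"
        using p s by (simp add: m_assoc)
      also have "?p [^] i \<otimes> s \<otimes> inv ?p = ?p [^] Suc i \<otimes> s"
        using p s unfolding sp by (simp add: m_assoc)
      also have "?p \<otimes> (?p [^] Suc i \<otimes> s) = ?p [^] Suc (Suc i) \<otimes> s"
        using p s by (simp only: nat_pow_Suc2 m_assoc nat_pow_closed m_closed)
      finally show ?thesis .
    qed
    ultimately show ?thesis by simp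
  qed
  have one: "conj_by s x = t \<longleftrightarrow> x = ?p [^] Suc 0 \<otimes> s"
  proof
    assume "conj_by s x = t"
    then have "s \<otimes> conj_by s x \<otimes> inv s = s \<otimes> t \<otimes> s" using ginv by simp
    then show "x = ?p [^] Suc 0 \<otimes> s" using s t Suc.prems by (simp add: m_assoc)
  next
    assume "x = ?p [^] Suc 0 \<otimes> s"
    then show "conj_by s x = t" using s t by (simp add: m_assoc)
  qed
  have yc: "?y \<in> carrier G" using s t Suc.prems by auto
  have "inversion_parity (concat (replicate (Suc k) [s, t])) x \<longleftrightarrow>
     ((x = s) \<noteq> ((conj_by s x = t) \<noteq> inversion_parity (concat (replicate k [s, t])) ?y))"
    by simp
  also have "\<dots> \<longleftrightarrow> ((x = ?p [^] (0::nat) \<otimes> s) \<noteq> ((x = ?p [^] Suc 0 \<otimes> s) \<noteq>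
      odd (\<Sum>i<2*k. of_bool (x = ?p [^] Suc (Suc i) \<otimes> s) :: nat)))"
    unfolding Suc.IH[OF yc] one shift using s by simp
  also have "\<dots> \<longleftrightarrow> odd (\<Sum>i<Suc (Suc (2*k)). of_bool (x = ?p [^] i \<otimes> s) :: nat)"
    unfolding sum.lessThan_Suc_shift by (auto simp del: nat_pow_Suc)
  finally show ?case by simp
qed simp

end

section \<open>Inversions of the elements of a Coxeter group\<close>

context finite_coxeter_system
begin

lemma gens_carrier: "S \<subseteq> carrier G"
  and gens_generate: "generate G S = carrier G"
  using presented by (auto simp: presented_by_def)

lemma gen_carrier [simp]: "s \<in> S \<Longrightarrow> s \<in> carrier G"
  using gens_carrier by auto

lemma lists_gens_carrier [simp]: "ss \<in> lists S \<Longrightarrow> ss \<in> lists (carrier G)"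
  using gens_carrier by (auto simp: lists_eq_set)

lemma relators_words: "coxeter_relators S m \<subseteq> words S"
  using presented by (auto simp: presented_by_def)

lemma word_eval_eq_iff:
  "v \<in> words S \<Longrightarrow> w \<in> words S \<Longrightarrow>
    word_eval G v = word_eval G w \<longleftrightarrow> presented_eq S (coxeter_relators S m) v w"
  using presented by (auto simp: presented_by_def)

lemma word_eval_relator: "r \<in> coxeter_relators S m \<Longrightarrow> word_eval G r = \<one>"
  using word_eval_eq_iff[of r "[]"] presented_eq.relator[of "[]" S "[]" r] relators_words
  by (auto simp: word_eval_def)

lemma word_eval_positive: "word_eval G (map (\<lambda>s. (s, True)) ss) = list_prod ss"
  by (induction ss) (auto simp: word_eval_def)

lemma relator_positive:
  "concat (replicate k [(s, True), (t, True)]) = map (\<lambda>s. (s, True)) (concat (replicate k [s, t]))"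
  by (induction k) auto

lemma gen_pair_pow: "s \<in> S \<Longrightarrow> t \<in> S \<Longrightarrow> (s \<otimes> t) [^] m s t = \<one>"
proof -
  assume st: "s \<in> S" "t \<in> S"
  have "list_prod (concat (replicate k [s, t])) = (s \<otimes> t) [^] k" for k
    using st by (induction k) (simp_all only: concat.simps replicate.simps append_Cons append_Nil list_prod_simps
        nat_pow_0 nat_pow_Suc2 m_closed gen_carrier m_assoc nat_pow_closed)
  then show ?thesis
    using word_eval_relator[of "concat (replicate (m s t) [(s, True), (t, True)])"] st
    unfolding relator_positive word_eval_positive
    by (auto simp: coxeter_relators_def relator_positive)
qed

lemma gen_involution [simp]: "s \<in> S \<Longrightarrow> s \<otimes> s = \<one>"
  using gen_pair_pow[of s s] m_diag by simp

lemma gen_inv [simp]: "s \<in> S \<Longrightarrow> inv s = s"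
  by (rule inv_equality) auto

text \<open>Generators are their own inverses, so signs may be forgotten; this lets signed words be
  fed to \<open>inversion_parity\<close> through \<open>map fst\<close>.\<close>

lemma word_eval_unsigned: "w \<in> words S \<Longrightarrow> word_eval G w = list_prod (map fst w)"
  by (induction w) (auto simp: word_eval_def)

text \<open>Along the relator the elements \<open>(st)^i s\<close> with \<open>i < 2 * m s t\<close>
  are met. Since \<open>(st)^(m s t) = 1\<close>, the second half of this list repeats the first,
  and every count is even.\<close>

lemma inversion_parity_relator:
  assumes "r \<in> coxeter_relators S m" "x \<in> carrier G"
  shows "\<not> inversion_parity (map fst r) x"
proof -
  obtain s t where st: "s \<in> S" "t \<in> S"
    and r: "r = concat (replicate (m s t) [(s, True), (t, True)])"
    using assms by (auto simp: coxeter_relators_def)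
  let ?k = "m s t" and ?f = "\<lambda>i::nat. of_bool (x = (s \<otimes> t) [^] i \<otimes> s) :: nat"
  have "map fst r = concat (replicate ?k [s, t])"
    unfolding r relator_positive by (simp add: comp_def)
  moreover have "sum ?f {..<2 * ?k} = 2 * sum ?f {..<?k}"
  proof -
    have split_sum: "sum ?f {..<n + k} = sum ?f {..<n} + (\<Sum>i<k. ?f (n + i))" for n k
      by (induction k) auto
    have "?f (?k + i) = ?f i" for i
      using st gen_pair_pow[OF st] by (simp flip: nat_pow_mult)
    then have "(\<Sum>i<?k. ?f (?k + i)) = sum ?f {..<?k}" by simp
    moreover have "sum ?f {..<?k + ?k} = sum ?f {..<?k} + (\<Sum>i<?k. ?f (?k + i))"
      by (rule split_sum)
    ultimately show ?thesis by (simp add: mult_2)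
  qed
  ultimately show ?thesis
    using st assms(2) by (simp add: inversion_parity_alternating)
qed

text \<open>Induction on the derivation. An inverse pair becomes \<open>s s\<close> once signs are
  dropped; a relator contributes even counts and, having product 1, leaves the tests of the letters
  after it unchanged.\<close>

lemma inversion_parity_presented_eq:
  assumes "presented_eq S (coxeter_relators S m) v w"
  shows "v \<in> words S \<and> w \<in> words S \<and>
    (\<forall>x\<in>carrier G. inversion_parity (map fst v) x \<longleftrightarrow> inversion_parity (map fst w) x)"
proof -
  have fst_words: "map fst u \<in> lists S" if "u \<in> words S" for u :: "'a word"
    using that by (induction u) auto
  show ?thesis
    using assms
  proof induction
    case (cancel u v s b)
    then have "map fst u \<in> lists (carrier G)" "map fst v \<in> lists (carrier G)"
      using fst_words lists_gens_carrier by blast+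
    moreover have "inversion_parity (s # s # map fst v) x \<longleftrightarrow> inversion_parity (map fst v) x"
      if "x \<in> carrier G" for x
      by (rule inversion_parity_involution) (use cancel(3) that in simp_all)
    ultimately show ?case
      using cancel by (simp add: inversion_parity_append)
  next
    case (relator u v r)
    have r: "r \<in> words S" using relator relators_words by auto
    have "list_prod (map fst r) = \<one>"
      using word_eval_relator[OF relator(3)] word_eval_unsigned[OF r] by simp
    moreover have "map fst u \<in> lists (carrier G)" "map fst v \<in> lists (carrier G)"
      "map fst r \<in> lists (carrier G)"
      using relator r fst_words lists_gens_carrier by blast+
    ultimately show ?case
      using relator r by (auto simp: inversion_parity_append inversion_parity_relator)
  qed auto
qed

text \<open>Evaluation is injective on the presented group, so positive words with equal products
  are linked by the defining relations.\<close>

lemma inversion_parity_cong: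
  assumes "us \<in> lists S" "vs \<in> lists S" "list_prod us = list_prod vs" "x \<in> carrier G"
  shows "inversion_parity us x \<longleftrightarrow> inversion_parity vs x"
proof -
  let ?p = "map (\<lambda>s. (s, True)) :: 'a list \<Rightarrow> 'a word"
  have "?p us \<in> words S" "?p vs \<in> words S"
    using assms by auto
  then have "presented_eq S (coxeter_relators S m) (?p us) (?p vs)"
    using assms(3) by (simp flip: word_eval_eq_iff add: word_eval_positive)
  from inversion_parity_presented_eq[OF this] assms(4) show ?thesis
    by (simp add: comp_def)
qed

lemma generate_list_prod:
  assumes "J \<subseteq> S"
  shows "generate G J = list_prod ` lists J"
proof (intro equalityI subsetI)
  fix g
  assume "g \<in> generate G J"
  then show "g \<in> list_prod ` lists J"
  proof induction
    case one
    show ?case by (rule image_eqI[of _ _ "[]"]) auto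
  next
    case (incl s)
    then show ?case using assms by (intro image_eqI[of _ _ "[s]"]) auto
  next
    case (inv s)
    then show ?case using assms by (intro image_eqI[of _ _ "[s]"]) auto
  next
    case (eng g h)
    then obtain us vs where "us \<in> lists J" "vs \<in> lists J" "g = list_prod us" "h = list_prod vs"
      by auto
    moreover from this have "us \<in> lists (carrier G)" "vs \<in> lists (carrier G)"
      using assms lists_mono[of J S] lists_gens_carrier by blast+
    ultimately show ?case
      by (intro image_eqI[of _ _ "us @ vs"]) (auto simp: list_prod_append)
  qed
next
  fix g
  assume "g \<in> list_prod ` lists J"
  then obtain ss where "ss \<in> lists J" "g = list_prod ss" by auto
  moreover have "ss \<in> lists J \<Longrightarrow> list_prod ss \<in> generate G J"
    by (induction ss) (auto intro: generate.intros)
  ultimately show "g \<in> generate G J" by simp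
qed

lemma obtain_word:
  assumes "g \<in> carrier G"
  obtains ss where "ss \<in> lists S" "list_prod ss = g"
  using assms generate_list_prod[OF order.refl] gens_generate by auto

text \<open>By \<open>inversion_parity_cong\<close> the choice of the word does not matter. For a
  reflection \<open>x\<close> this says that \<open>x\<close> is a left inversion of
  \<open>g\<close>, see \<open>len_reflection_less_iff\<close>.\<close>

definition inverts :: "'a \<Rightarrow> 'a \<Rightarrow> bool" where
  "inverts g x \<longleftrightarrow> (\<exists>ss\<in>lists S. list_prod ss = g \<and> inversion_parity ss x)"

lemma inverts_list_prod:
  "ss \<in> lists S \<Longrightarrow> x \<in> carrier G \<Longrightarrow> inverts (list_prod ss) x \<longleftrightarrow> inversion_parity ss x"
  unfolding inverts_def using inversion_parity_cong by blast

lemma inverts_one [simp]: "x \<in> carrier G \<Longrightarrow> \<not> inverts \<one> x"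
  using inverts_list_prod[of "[]"] by simp

lemma inverts_gen: "s \<in> S \<Longrightarrow> x \<in> carrier G \<Longrightarrow> inverts s x \<longleftrightarrow> x = s"
  using inverts_list_prod[of "[s]"] by simp

lemma inverts_mult:
  assumes "g \<in> carrier G" "h \<in> carrier G" "x \<in> carrier G"
  shows "inverts (g \<otimes> h) x \<longleftrightarrow> inverts g x \<noteq> inverts h (conj_by g x)"
proof -
  obtain us where us: "us \<in> lists S" "list_prod us = g"
    using obtain_word[OF assms(1)] .
  obtain vs where vs: "vs \<in> lists S" "list_prod vs = h"
    using obtain_word[OF assms(2)] .
  have "conj_by g x \<in> carrier G" using assms by simp
  moreover have "us @ vs \<in> lists S" using us vs by simp
  moreover have "list_prod (us @ vs) = g \<otimes> h"
    using us vs by (simp only: list_prod_append lists_gens_carrier)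
  moreover have "us \<in> lists (carrier G)" "vs \<in> lists (carrier G)"
    using us vs lists_gens_carrier by blast+
  ultimately show ?thesis
    using us vs assms inverts_list_prod inversion_parity_append by metis
qed

section \<open>Length and strong exchange\<close>

abbreviation len :: "'a \<Rightarrow> nat" where
  "len \<equiv> coxeter_length G S"

lemma len_list_prod_le: "ss \<in> lists S \<Longrightarrow> len (list_prod ss) \<le> length ss"
  unfolding coxeter_length_def by (rule Least_le) (auto simp: list_prod_def)

lemma obtain_reduced_word:
  assumes "g \<in> carrier G"
  obtains ss where "ss \<in> lists S" "list_prod ss = g" "length ss = len g"
proof -
  obtain ss where "ss \<in> lists S" "list_prod ss = g" using obtain_word[OF assms] .
  then have "\<exists>n. \<exists>ss\<in>lists S. length ss = n \<and> foldr (\<otimes>) ss \<one> = g"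
    unfolding list_prod_def by blast
  from LeastI_ex[OF this] show thesis
    using that unfolding coxeter_length_def list_prod_def by blast
qed

text \<open>An odd count exhibits \<open>x\<close> as \<open>u s u^-1\<close> with \<open>u\<close>
  the product of a prefix followed by the letter \<open>s\<close>; multiplying by such an element
  deletes that letter.\<close>

lemma strong_exchange:
  assumes "ss \<in> lists S" "x \<in> carrier G" "inversion_parity ss x"
  obtains us s vs where "ss = us @ s # vs" "x \<otimes> list_prod ss = list_prod (us @ vs)"
proof -
  obtain us s vs where ss: "ss = us @ s # vs"
    and x: "x = list_prod us \<otimes> s \<otimes> inv (list_prod us)"
    using inversion_parity_delete[OF _ assms(2,3)] assms(1) lists_gens_carrier by blast
  have "us \<in> lists (carrier G)" "vs \<in> lists (carrier G)" "s \<in> S"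
    using assms(1) gens_carrier unfolding ss by auto
  then have "x \<otimes> list_prod ss = list_prod (us @ vs)"
    unfolding x ss by (intro list_prod_delete) auto
  with ss show thesis using that by blast
qed

section \<open>Reflections and their inversions\<close>

abbreviation refls :: "'a set" where
  "refls \<equiv> reflections G S"

lemma reflectionE:
  assumes "t \<in> refls"
  obtains u s where "u \<in> carrier G" "s \<in> S" "t = u \<otimes> s \<otimes> inv u"
  using assms by (auto simp: reflections_def)

lemma reflection_carrier [simp]: "t \<in> refls \<Longrightarrow> t \<in> carrier G"
  by (auto simp: reflections_def)

lemma reflection_involution [simp]: "t \<in> refls \<Longrightarrow> t \<otimes> t = \<one>"
proof -
  assume "t \<in> refls"
  then obtain u s where u: "u \<in> carrier G" "s \<in> S" "t = u \<otimes> s \<otimes> inv u"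
    by (rule reflectionE)
  then have "t \<otimes> t = u \<otimes> (s \<otimes> s) \<otimes> inv u"
    by (simp only: m_assoc inv_mult_cancel gen_carrier m_closed inv_closed)
  with u show ?thesis by simp
qed

lemma reflection_cancel [simp]: "t \<in> refls \<Longrightarrow> x \<in> carrier G \<Longrightarrow> t \<otimes> (t \<otimes> x) = x"
  by (simp flip: m_assoc)

lemma reflection_inv [simp]: "t \<in> refls \<Longrightarrow> inv t = t"
  by (rule inv_equality) auto

lemma gen_reflection: "s \<in> S \<Longrightarrow> s \<in> refls"
proof -
  assume "s \<in> S"
  moreover from this have "s = \<one> \<otimes> s \<otimes> inv \<one>" by simp
  ultimately show ?thesis unfolding reflections_def by blast
qed

lemma reflection_conj: "t \<in> refls \<Longrightarrow> g \<in> carrier G \<Longrightarrow> g \<otimes> t \<otimes> inv g \<in> refls"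
proof -
  assume "t \<in> refls" and g: "g \<in> carrier G"
  then obtain u s where u: "u \<in> carrier G" "s \<in> S" "t = u \<otimes> s \<otimes> inv u"
    using reflectionE by blast
  then have "g \<otimes> t \<otimes> inv g = (g \<otimes> u) \<otimes> s \<otimes> inv (g \<otimes> u)"
    using g by (simp add: m_assoc inv_mult_group)
  with u g show ?thesis unfolding reflections_def by blast
qed

text \<open>Write \<open>t = u s u^-1\<close>. Since \<open>u u^-1 = 1\<close> has no inversions,
  the contributions of \<open>u\<close> and \<open>u^-1\<close> agree and cancel; the middle letter
  \<open>s\<close> contributes exactly once.\<close>

lemma inverts_reflection_self: "t \<in> refls \<Longrightarrow> inverts t t"
proof -
  assume "t \<in> refls"
  then obtain u s where u: "u \<in> carrier G" "s \<in> S" "t = u \<otimes> s \<otimes> inv u"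
    by (rule reflectionE)
  have sc: "s \<in> carrier G" and tc: "t \<in> carrier G" using u by auto
  have t1: "conj_by u t = s" and t2: "conj_by (u \<otimes> s) t = s"
    using u by (simp_all add: m_assoc inv_mult_group)
  have "inverts (u \<otimes> inv u) t \<longleftrightarrow> inverts u t \<noteq> inverts (inv u) s"
    using inverts_mult[of u "inv u" t] u tc t1 by simp
  then have "inverts (inv u) s \<longleftrightarrow> inverts u t" using u tc by simp
  moreover have "inverts t t \<longleftrightarrow> inverts (u \<otimes> s) t \<noteq> inverts (inv u) s"
    using inverts_mult[of "u \<otimes> s" "inv u" t] u sc tc t2 by simp
  moreover have "inverts (u \<otimes> s) t \<longleftrightarrow> inverts u t \<noteq> inverts s s"
    using inverts_mult[of u s t] u sc tc t1 by simp
  moreover have "inverts s s" using inverts_gen u by simp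
  ultimately show ?thesis by blast
qed

lemma inverts_reflection_mult:
  assumes "t \<in> refls" "w \<in> carrier G"
  shows "inverts (t \<otimes> w) t \<longleftrightarrow> \<not> inverts w t"
  using inverts_mult[of t w t] inverts_reflection_self assms by (simp add: m_assoc)

lemma len_reflection_less:
  assumes "w \<in> carrier G" "t \<in> carrier G" "inverts w t"
  shows "len (t \<otimes> w) < len w"
proof -
  obtain ss where ss: "ss \<in> lists S" "list_prod ss = w" "length ss = len w"
    using obtain_reduced_word[OF assms(1)] .
  then have "inversion_parity ss t"
    using inverts_list_prod assms by blast
  from strong_exchange[OF ss(1) assms(2) this] obtain us s vs
    where e: "ss = us @ s # vs" "t \<otimes> w = list_prod (us @ vs)"
    using ss by metis
  then have "us @ vs \<in> lists S" using ss by auto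
  from len_list_prod_le[OF this] show ?thesis
    using e ss by simp
qed

text \<open>Strong exchange gives one direction. For the other, \<open>t\<close> is an inversion of
  exactly one of \<open>w\<close> and \<open>tw\<close>, so if it is none of \<open>w\<close>, then
  \<open>w\<close> is the shorter one.\<close>

lemma len_reflection_less_iff:
  assumes "w \<in> carrier G" "t \<in> refls"
  shows "len (t \<otimes> w) < len w \<longleftrightarrow> inverts w t"
proof
  assume less: "len (t \<otimes> w) < len w"
  show "inverts w t"
  proof (rule ccontr)
    assume "\<not> inverts w t"
    then have "len (t \<otimes> (t \<otimes> w)) < len (t \<otimes> w)"
      using assms inverts_reflection_mult by (intro len_reflection_less) auto
    then show False using less assms by simp
  qed
qed (use assms len_reflection_less in auto)

end

section \<open>Parabolic subgroups\<close>

locale coxeter_parabolic = finite_coxeter_system +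
  fixes I
  assumes subset_gens: "I \<subseteq> S"
begin

abbreviation parabolic :: "'a set" where
  "parabolic \<equiv> generate G I"

lemma gens_subset_carrier: "I \<subseteq> carrier G"
  using subset_gens gens_carrier by blast

lemma lists_subset_gens: "ss \<in> lists I \<Longrightarrow> ss \<in> lists S"
  using subset_gens lists_mono by blast

lemma parabolic_subgroup: "subgroup parabolic G"
  by (rule generate_is_subgroup[OF gens_subset_carrier])

lemma parabolic_carrier [simp]: "u \<in> parabolic \<Longrightarrow> u \<in> carrier G"
  using subgroup.mem_carrier[OF parabolic_subgroup] .

lemma parabolic_mult [simp]: "u \<in> parabolic \<Longrightarrow> v \<in> parabolic \<Longrightarrow> u \<otimes> v \<in> parabolic"
  using subgroup.m_closed[OF parabolic_subgroup] .

lemma parabolic_inv [simp]: "u \<in> parabolic \<Longrightarrow> inv u \<in> parabolic"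
  using subgroup.m_inv_closed[OF parabolic_subgroup] .

lemma parabolic_one [simp]: "\<one> \<in> parabolic"
  by (rule generate.one)

lemma parabolic_mult_left_iff:
  assumes "u \<in> parabolic" "x \<in> carrier G"
  shows "u \<otimes> x \<in> parabolic \<longleftrightarrow> x \<in> parabolic"
  using assms parabolic_mult[of "inv u" "u \<otimes> x"] by auto

lemma parabolic_mult_right_iff:
  assumes "u \<in> parabolic" "x \<in> carrier G"
  shows "x \<otimes> u \<in> parabolic \<longleftrightarrow> x \<in> parabolic"
  using assms parabolic_mult[of "x \<otimes> u" "inv u"] by (auto simp: m_assoc)

text \<open>Along a word over \<open>I\<close>, every element met is a conjugate of a letter in
  \<open>I\<close> by a product of letters in \<open>I\<close>.\<close>

lemma parabolic_inverts:
  assumes "u \<in> parabolic" "x \<in> carrier G" "inverts u x"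
  shows "x \<in> parabolic"
proof -
  obtain ss where ss: "ss \<in> lists I" "u = list_prod ss"
    using assms(1) generate_list_prod[OF subset_gens] by auto
  have p: "inversion_parity ss x"
    using assms ss lists_subset_gens inverts_list_prod by blast
  have "ss \<in> lists (carrier G)" using ss lists_subset_gens lists_gens_carrier by blast
  from inversion_parity_delete[OF this assms(2) p] obtain us s vs where
    e: "ss = us @ s # vs" "x = list_prod us \<otimes> s \<otimes> inv (list_prod us)" .
  have "list_prod us \<in> parabolic" "s \<in> parabolic"
    using ss e generate_list_prod[OF subset_gens] by (auto intro: generate.incl)
  then show ?thesis using e by simp
qed

text \<open>Take a word for \<open>u\<close> that is shortest among the words over \<open>I\<close>.
  If its first letter \<open>s\<close> were not inverted, \<open>s\<close> would be inverted by the
  tail, and exchange there would give a shorter word over \<open>I\<close>.\<close>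

lemma parabolic_inverts_gen:
  assumes "u \<in> parabolic" "u \<noteq> \<one>"
  obtains s where "s \<in> I" "inverts u s"
proof -
  define P where "P ss \<longleftrightarrow> ss \<in> lists I \<and> list_prod ss = u" for ss
  have "\<exists>ss. P ss"
    using assms(1) generate_list_prod[OF subset_gens] unfolding P_def by auto
  then obtain ss where ss: "P ss" and min: "\<And>ts. P ts \<Longrightarrow> length ss \<le> length ts"
    using ex_has_least_nat[of P] by blast
  obtain s rs where sr: "ss = s # rs"
    using ss assms(2) by (cases ss) (auto simp: P_def)
  have s: "s \<in> I" "s \<in> S" and rs: "rs \<in> lists I" "rs \<in> lists S"
    using ss sr subset_gens by (auto simp: P_def)
  have cs: "conj_by s s = s" using s by simp
  have "inversion_parity ss s"
  proof (rule ccontr)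
    assume "\<not> inversion_parity ss s"
    then have "inversion_parity rs s" using sr cs by simp
    from strong_exchange[OF rs(2) _ this] s obtain us r vs where
      e: "rs = us @ r # vs" "s \<otimes> list_prod rs = list_prod (us @ vs)" by auto
    then have "P (us @ vs)" using ss sr rs by (auto simp: P_def)
    from min[OF this] show False using e sr by simp
  qed
  moreover have "ss \<in> lists S" "list_prod ss = u"
    using ss lists_subset_gens by (auto simp: P_def)
  ultimately show thesis
    using that s inverts_list_prod gen_carrier by metis
qed

text \<open>The only inversion of \<open>s\<close> is \<open>s\<close> itself, while a nontrivial
  element of \<open>W\<^sub>I\<close> has an inversion in \<open>I\<close>.\<close>

lemma gen_in_parabolic_iff: "s \<in> S \<Longrightarrow> s \<in> parabolic \<longleftrightarrow> s \<in> I"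
proof
  assume s: "s \<in> S" "s \<in> parabolic"
  have "inverts s s" using s inverts_gen by simp
  then have "s \<noteq> \<one>" using inverts_one s by auto
  then obtain r where "r \<in> I" "inverts s r"
    using parabolic_inverts_gen s by blast
  then show "s \<in> I" using s inverts_gen[of s r] gens_subset_carrier by auto
qed (rule generate.incl)

section \<open>Cosets and their minimal representatives\<close>

abbreviation coset :: "'a \<Rightarrow> 'a set" where
  "coset w \<equiv> w <# parabolic"

abbreviation cosets :: "'a set set" where
  "cosets \<equiv> lcosets parabolic"

lemma mem_coset_iff:
  "w \<in> carrier G \<Longrightarrow> v \<in> carrier G \<Longrightarrow> v \<in> coset w \<longleftrightarrow> inv w \<otimes> v \<in> parabolic"
  unfolding l_coset_def by force

lemma coset_carrier: "w \<in> carrier G \<Longrightarrow> v \<in> coset w \<Longrightarrow> v \<in> carrier G"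
  unfolding l_coset_def by auto

lemma coset_eq_iff:
  assumes "w \<in> carrier G" "v \<in> carrier G"
  shows "coset w = coset v \<longleftrightarrow> inv w \<otimes> v \<in> parabolic"
proof
  assume "coset w = coset v"
  moreover have "v \<in> coset v" using assms mem_coset_iff by simp
  ultimately show "inv w \<otimes> v \<in> parabolic" using assms mem_coset_iff by blast
next
  assume "inv w \<otimes> v \<in> parabolic"
  then show "coset w = coset v"
    using assms l_repr_independence parabolic_subgroup mem_coset_iff by blast
qed

lemma coset_mult:
  "g \<in> carrier G \<Longrightarrow> w \<in> carrier G \<Longrightarrow> g <# coset w = coset (g \<otimes> w)"
  unfolding l_coset_def by (auto simp: m_assoc)

lemma coset_one: "coset \<one> = parabolic"
  unfolding l_coset_def by auto

lemma coset_parabolic_mult: "w \<in> carrier G \<Longrightarrow> u \<in> parabolic \<Longrightarrow> coset (w \<otimes> u) = coset w"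
  by (subst eq_commute, subst coset_eq_iff) auto

lemma coset_in_cosets [simp]: "w \<in> carrier G \<Longrightarrow> coset w \<in> cosets"
  by (auto simp: LCOSETS_def)

lemma cosetsE:
  assumes "C \<in> cosets"
  obtains w where "w \<in> carrier G" "C = coset w"
  using assms by (auto simp: LCOSETS_def)

text \<open>If \<open>y = xu\<close> with \<open>u \<noteq> \<one>\<close>, pick \<open>s\<close> in
  \<open>I\<close> inverted by \<open>u\<close> and let \<open>t = x s x^-1\<close>. By the cocycle
  identity \<open>t\<close> is an inversion of exactly one of \<open>x\<close> and \<open>y\<close>,
  and it shortens that one without leaving the coset.\<close>

lemma minimal_in_coset_unique:
  assumes w: "w \<in> carrier G"
    and x: "x \<in> coset w" "\<And>v. v \<in> coset w \<Longrightarrow> len x \<le> len v"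
    and y: "y \<in> coset w" "\<And>v. v \<in> coset w \<Longrightarrow> len y \<le> len v"
  shows "x = y"
proof (rule ccontr)
  assume "x \<noteq> y"
  have c: "x \<in> carrier G" "y \<in> carrier G" using w x y coset_carrier by blast+
  define u where "u = inv x \<otimes> y"
  have cx: "coset w = coset x"
    using c w x mem_coset_iff coset_eq_iff by blast
  then have u: "u \<in> parabolic" using c y(1) mem_coset_iff unfolding u_def by blast
  have yu: "y = x \<otimes> u" using c by (simp add: u_def)
  have "u \<noteq> \<one>" using yu c \<open>x \<noteq> y\<close> by auto
  then obtain s where s: "s \<in> I" "inverts u s" using u parabolic_inverts_gen by blast
  have sc: "s \<in> S" "s \<in> carrier G" "s \<in> parabolic"
    using s subset_gens by (auto intro: generate.incl)
  define t where "t = x \<otimes> s \<otimes> inv x"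
  have t: "t \<in> refls" unfolding t_def reflections_def using c sc by blast
  have tx: "t \<otimes> x = x \<otimes> s" and ty: "t \<otimes> y = x \<otimes> (s \<otimes> u)" and ct: "conj_by x t = s"
    using c sc u unfolding t_def yu by (simp_all add: m_assoc)
  have "t \<otimes> x \<in> coset w" "t \<otimes> y \<in> coset w"
    using c sc u unfolding cx tx ty by (simp_all add: mem_coset_iff)
  with x y have "\<not> len (t \<otimes> x) < len x" "\<not> len (t \<otimes> y) < len y"
    by (simp_all add: not_less)
  then have "\<not> inverts x t" "\<not> inverts y t"
    using len_reflection_less_iff c t by blast+
  moreover have "inverts y t \<longleftrightarrow> inverts x t \<noteq> inverts u s"
    using inverts_mult[of x u t] c u t ct yu by simp
  ultimately show False using s by blast
qed

lemma min_rep_props: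
  assumes "w \<in> carrier G"
  shows min_rep_in_coset: "min_rep G S I w \<in> coset w"
    and min_rep_le: "v \<in> coset w \<Longrightarrow> len (min_rep G S I w) \<le> len v"
proof -
  have "w \<in> coset w" using assms mem_coset_iff by simp
  then obtain x where x: "x \<in> coset w" "\<And>v. v \<in> coset w \<Longrightarrow> len x \<le> len v"
    using ex_has_least_nat[of "\<lambda>v. v \<in> coset w" w len] by blast
  have "min_rep G S I w = x"
    unfolding min_rep_def
  proof (rule the_equality)
    show "is_arg_min len (\<lambda>v. v \<in> coset w) x"
      using x unfolding is_arg_min_def by (simp add: not_less)
  next
    fix y
    assume "is_arg_min len (\<lambda>v. v \<in> coset w) y"
    then show "y = x"
      using minimal_in_coset_unique[OF assms _ _ x] unfolding is_arg_min_def
      by (simp add: not_less)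
  qed
  with x show "min_rep G S I w \<in> coset w"
    "v \<in> coset w \<Longrightarrow> len (min_rep G S I w) \<le> len v" by simp_all
qed

lemma min_rep_cong: "coset w = coset v \<Longrightarrow> min_rep G S I w = min_rep G S I v"
  by (simp add: min_rep_def)

section \<open>Foldings\<close>

text \<open>\<open>b\<close> selects the folding: \<open>True\<close> is \<open>t\<^sup>+\<close>, moving the right cosets, and \<open>False\<close> is \<open>t\<^sup>-\<close>.\<close>

definition moved :: "bool \<Rightarrow> 'a \<Rightarrow> 'a \<Rightarrow> bool" where
  "moved b t w \<longleftrightarrow> conj_by w t \<notin> parabolic \<and> inverts w t = b"

lemma conj_by_reflection [simp]:
  "t \<in> refls \<Longrightarrow> w \<in> carrier G \<Longrightarrow> conj_by (t \<otimes> w) t = conj_by w t"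
  by (simp add: conj_by_mult)

lemma moved_reflection_mult:
  "t \<in> refls \<Longrightarrow> w \<in> carrier G \<Longrightarrow> moved b t (t \<otimes> w) \<longleftrightarrow> moved (\<not> b) t w"
  unfolding moved_def by (auto simp: inverts_reflection_mult)

lemma coset_reflection_fixed:
  assumes "t \<in> refls" "w \<in> carrier G"
  shows "coset (t \<otimes> w) = coset w \<longleftrightarrow> conj_by w t \<in> parabolic"
  using assms coset_eq_iff[of "t \<otimes> w" w] by (simp add: inv_mult_group)

text \<open>For \<open>v = wu\<close> the inversion status of \<open>t\<close> changes only if
  \<open>u\<close> inverts \<open>w^-1 t w\<close>. That puts \<open>w^-1 t w\<close> into
  \<open>W\<^sub>I\<close>, in which case neither representative is moved.\<close>

lemma moved_cong:
  assumes "w \<in> carrier G" "v \<in> carrier G" "t \<in> refls" "coset w = coset v"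
  shows "moved b t w \<longleftrightarrow> moved b t v"
proof -
  define u where "u = inv w \<otimes> v"
  have u: "u \<in> parabolic" using assms coset_eq_iff unfolding u_def by blast
  have v: "v = w \<otimes> u" using assms unfolding u_def by simp
  have cc: "conj_by w t \<in> carrier G" using assms by simp
  have "conj_by v t = inv u \<otimes> (conj_by w t \<otimes> u)"
    using assms u unfolding v by (simp add: m_assoc inv_mult_group)
  then have "conj_by v t \<in> parabolic \<longleftrightarrow> conj_by w t \<in> parabolic"
    using u cc parabolic_mult_left_iff[of "inv u" "conj_by w t \<otimes> u"]
      parabolic_mult_right_iff[of u "conj_by w t"] by simp
  moreover have "inverts v t \<longleftrightarrow> inverts w t" if "conj_by w t \<notin> parabolic"
    using inverts_mult[of w u t] parabolic_inverts[OF u cc] that assms u unfolding v by auto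
  ultimately show ?thesis unfolding moved_def by blast
qed

text \<open>The minimal representative \<open>v\<close> of the coset is moved as well, so
  \<open>tv\<close> is shorter than \<open>v\<close>, and \<open>tv\<close> bounds the minimum of
  the coset of \<open>tw\<close>.\<close>

lemma min_rep_decrease:
  assumes t: "t \<in> refls" and w: "w \<in> carrier G" and "moved True t w"
  shows "len (min_rep G S I (t \<otimes> w)) < len (min_rep G S I w)"
proof -
  define v where "v = min_rep G S I w"
  have v: "v \<in> coset w" "v \<in> carrier G"
    using min_rep_in_coset[OF w] coset_carrier w unfolding v_def by blast+
  then have "coset v = coset w" using w mem_coset_iff coset_eq_iff by blast
  then have "moved True t v" using assms v moved_cong by blast
  then have "len (t \<otimes> v) < len v"
    using len_reflection_less_iff t v unfolding moved_def by blast
  moreover have "t \<otimes> v \<in> coset (t \<otimes> w)"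
    using v t w by (simp add: mem_coset_iff inv_mult_group m_assoc)
  ultimately show ?thesis
    using min_rep_le[of "t \<otimes> w"] t w unfolding v_def by fastforce
qed

lemma min_rep_trichotomy:
  assumes "t \<in> refls" "w \<in> carrier G"
  shows "len (min_rep G S I (t \<otimes> w)) < len (min_rep G S I w) \<longleftrightarrow> moved True t w"
    and "len (min_rep G S I (t \<otimes> w)) > len (min_rep G S I w) \<longleftrightarrow> moved False t w"
    and "len (min_rep G S I (t \<otimes> w)) = len (min_rep G S I w) \<longleftrightarrow>
      \<not> moved True t w \<and> \<not> moved False t w"
proof -
  \<comment> \<open>Multiplying by \<open>t\<close> swaps the two sides, so this is the decrease for
    \<open>tw\<close>.\<close>
  have "len (min_rep G S I w) < len (min_rep G S I (t \<otimes> w))" if "moved False t w"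
    using min_rep_decrease[of t "t \<otimes> w"] moved_reflection_mult[of t w True] assms that by simp
  moreover have "len (min_rep G S I (t \<otimes> w)) = len (min_rep G S I w)"
    if "\<not> moved True t w" "\<not> moved False t w"
  proof -
    have "conj_by w t \<in> parabolic" using that unfolding moved_def by blast
    then show ?thesis using coset_reflection_fixed min_rep_cong assms by metis
  qed
  moreover have "\<not> (moved True t w \<and> moved False t w)" unfolding moved_def by blast
  moreover note min_rep_decrease[OF assms]
  ultimately show "len (min_rep G S I (t \<otimes> w)) < len (min_rep G S I w) \<longleftrightarrow> moved True t w"
    "len (min_rep G S I (t \<otimes> w)) > len (min_rep G S I w) \<longleftrightarrow> moved False t w"
    "len (min_rep G S I (t \<otimes> w)) = len (min_rep G S I w) \<longleftrightarrow>
      \<not> moved True t w \<and> \<not> moved False t w"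
    by (smt (verit) less_irrefl less_asym)+
qed

lemma side_iff:
  assumes "t \<in> refls" "w \<in> carrier G"
  shows "coset w \<in> right_cosets_of G S I t \<longleftrightarrow> moved True t w"
    and "coset w \<in> left_cosets_of G S I t \<longleftrightarrow> moved False t w"
    and "coset w \<in> fixed_cosets_of G S I t \<longleftrightarrow> \<not> moved True t w \<and> \<not> moved False t w"
proof -
  \<comment> \<open>A side is defined through some representative of the coset; a predicate constant
    on cosets may be tested on the given one.\<close>
  have mem: "coset w \<in> {coset v | v. v \<in> carrier G \<and> P v} \<longleftrightarrow> Q w"
    if "\<And>v. v \<in> carrier G \<Longrightarrow> P v \<longleftrightarrow> Q v"
      and "\<And>v. v \<in> carrier G \<Longrightarrow> coset w = coset v \<Longrightarrow> Q w \<longleftrightarrow> Q v" for P Q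
    using that assms(2) by blast
  have cong: "moved b t w \<longleftrightarrow> moved b t v" if "v \<in> carrier G" "coset w = coset v" for b v
    using moved_cong[OF assms(2) that(1) assms(1) that(2)] .
  show "coset w \<in> right_cosets_of G S I t \<longleftrightarrow> moved True t w"
    unfolding right_cosets_of_def
    by (rule mem) (use min_rep_trichotomy(1)[OF assms(1)] cong in blast)+
  show "coset w \<in> left_cosets_of G S I t \<longleftrightarrow> moved False t w"
    unfolding left_cosets_of_def
    by (rule mem) (use min_rep_trichotomy(2)[OF assms(1)] cong in blast)+
  show "coset w \<in> fixed_cosets_of G S I t \<longleftrightarrow> \<not> moved True t w \<and> \<not> moved False t w"
    unfolding fixed_cosets_of_def
    by (rule mem) (use min_rep_trichotomy(3)[OF assms(1)] cong in blast)+
qed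

lemma fold_set_iff:
  assumes "t \<in> refls" "w \<in> carrier G"
  shows "coset w \<in> left_fold_set G S I t J \<longleftrightarrow> coset (if moved True t w then t \<otimes> w else w) \<in> J"
    and "coset w \<in> right_fold_set G S I t J \<longleftrightarrow> coset (if moved False t w then t \<otimes> w else w) \<in> J"
  using assms unfolding left_fold_set_def right_fold_set_def left_folding_def right_folding_def
  by (simp_all add: side_iff coset_mult)

lemma fold_set_subset:
  "left_fold_set G S I t J \<subseteq> cosets" "right_fold_set G S I t J \<subseteq> cosets"
  by (auto simp: left_fold_set_def right_fold_set_def)

lemma cosets_eqI:
  assumes "J \<subseteq> cosets" "J' \<subseteq> cosets"
    and "\<And>w. w \<in> carrier G \<Longrightarrow> coset w \<in> J \<longleftrightarrow> coset w \<in> J'"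
  shows "J = J'"
proof (rule Set.set_eqI)
  fix C
  show "C \<in> J \<longleftrightarrow> C \<in> J'"
  proof (cases "C \<in> cosets")
    case True
    then obtain w where "w \<in> carrier G" "C = coset w" by (rule cosetsE)
    then show ?thesis using assms(3) by simp
  next
    case False
    then show ?thesis using assms(1,2) by blast
  qed
qed

text \<open>Both foldings become one condition on representatives with a Boolean \<open>b\<close>.
  Being left or fixed means not being moved by the left folding, and dually, so the two meeting
  conditions become one statement for all \<open>c\<close>.\<close>

lemma strong_folding_step_iff:
  assumes J: "J \<subseteq> cosets" and J': "J' \<subseteq> cosets"
  shows "strong_folding_step G S I J J' \<longleftrightarrow> (\<exists>t\<in>refls. \<exists>b.
    (\<forall>w\<in>carrier G. coset w \<in> J' \<longleftrightarrow> coset (if moved b t w then t \<otimes> w else w) \<in> J) \<and>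
    (\<forall>c. \<exists>w\<in>carrier G. coset w \<in> J \<and> \<not> moved c t w))"
proof -
  have fold: "J' = left_fold_set G S I t J \<or> J' = right_fold_set G S I t J \<longleftrightarrow>
    (\<exists>b. \<forall>w\<in>carrier G. coset w \<in> J' \<longleftrightarrow> coset (if moved b t w then t \<otimes> w else w) \<in> J)"
    if t: "t \<in> refls" for t
  proof -
    have "J' = left_fold_set G S I t J \<longleftrightarrow>
      (\<forall>w\<in>carrier G. coset w \<in> J' \<longleftrightarrow> coset (if moved True t w then t \<otimes> w else w) \<in> J)"
      using cosets_eqI[OF J' fold_set_subset(1)] fold_set_iff(1)[OF t] by blast
    moreover have "J' = right_fold_set G S I t J \<longleftrightarrow>
      (\<forall>w\<in>carrier G. coset w \<in> J' \<longleftrightarrow> coset (if moved False t w then t \<otimes> w else w) \<in> J)"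
      using cosets_eqI[OF J' fold_set_subset(2)] fold_set_iff(2)[OF t] by blast
    ultimately show ?thesis by (simp only: ex_bool_eq)
  qed
  have side: "J \<inter> (left_cosets_of G S I t \<union> fixed_cosets_of G S I t) \<noteq> {} \<and>
      J \<inter> (right_cosets_of G S I t \<union> fixed_cosets_of G S I t) \<noteq> {} \<longleftrightarrow>
    (\<forall>c. \<exists>w\<in>carrier G. coset w \<in> J \<and> \<not> moved c t w)" if t: "t \<in> refls" for t
  proof -
    have ex: "J \<inter> Y \<noteq> {} \<longleftrightarrow> (\<exists>w\<in>carrier G. coset w \<in> J \<and> coset w \<in> Y)" for Y
      using J cosetsE by blast
    have "moved True t w \<Longrightarrow> moved False t w \<Longrightarrow> False" for w
      unfolding moved_def by blast
    then show ?thesis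
      unfolding ex all_bool_eq using side_iff[OF t] by (simp cong: bex_cong) blast
  qed
  show ?thesis
    unfolding strong_folding_step_def using fold side by (simp cong: bex_cong)
qed

lemma strong_folding_stepI:
  assumes "t \<in> refls" "J \<subseteq> cosets" "J' \<subseteq> cosets"
    and "\<And>w. w \<in> carrier G \<Longrightarrow>
      coset w \<in> J' \<longleftrightarrow> coset (if moved b t w then t \<otimes> w else w) \<in> J"
    and "\<And>c. \<exists>w\<in>carrier G. coset w \<in> J \<and> \<not> moved c t w"
  shows "strong_folding_step G S I J J'"
  unfolding strong_folding_step_iff[OF assms(2,3)]
proof (rule bexI[OF _ assms(1)], rule exI[of _ b], rule conjI)
  show "\<forall>w\<in>carrier G. coset w \<in> J' \<longleftrightarrow> coset (if moved b t w then t \<otimes> w else w) \<in> J"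
    using assms(4) by (rule ballI)
  show "\<forall>c. \<exists>w\<in>carrier G. coset w \<in> J \<and> \<not> moved c t w"
    using assms(5) by (rule allI)
qed

lemma strong_folding_step_subset: "strong_folding_step G S I J J' \<Longrightarrow> J' \<subseteq> cosets"
  using fold_set_subset unfolding strong_folding_step_def by blast

section \<open>Translates of strong foldings\<close>

abbreviation translate :: "'a \<Rightarrow> 'a set set \<Rightarrow> 'a set set" where
  "translate g J \<equiv> l_coset G g ` J"

lemma translate_mem_iff:
  assumes "J \<subseteq> cosets" "g \<in> carrier G" "w \<in> carrier G"
  shows "coset w \<in> translate g J \<longleftrightarrow> coset (inv g \<otimes> w) \<in> J"
proof
  assume "coset w \<in> translate g J"
  then obtain C where C: "C \<in> J" "coset w = g <# C" by blast
  with assms(1) obtain v where "v \<in> carrier G" "C = coset v" using cosetsE by blast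
  with C assms(2) have v: "v \<in> carrier G" "coset v \<in> J" "coset w = coset (g \<otimes> v)"
    by (simp_all add: coset_mult)
  then have "inv g <# coset w = inv g <# coset (g \<otimes> v)" by simp
  then have "coset (inv g \<otimes> w) = coset v" using v(1) assms(2,3) by (simp add: coset_mult)
  then show "coset (inv g \<otimes> w) \<in> J" using v(2) by simp
next
  assume "coset (inv g \<otimes> w) \<in> J"
  moreover have "coset w = g <# coset (inv g \<otimes> w)" using assms by (simp add: coset_mult)
  ultimately show "coset w \<in> translate g J" by blast
qed

lemma translate_subset: "J \<subseteq> cosets \<Longrightarrow> g \<in> carrier G \<Longrightarrow> translate g J \<subseteq> cosets"
proof
  fix C
  assume "J \<subseteq> cosets" and g: "g \<in> carrier G" and "C \<in> translate g J"
  then obtain v where "v \<in> carrier G" "C = g <# coset v" using cosetsE by blast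
  with g show "C \<in> cosets" by (simp add: coset_mult)
qed

lemma translate_cosets: "g \<in> carrier G \<Longrightarrow> translate g cosets = cosets"
  by (rule cosets_eqI) (simp_all add: translate_subset translate_mem_iff)

text \<open>
  Translating by \<open>g\<close> turns \<open>t\<close> into \<open>gtg\<inverse>\<close>; this may exchange the left and the right side, but
  both foldings are available and the condition on \<open>J\<close> is symmetric.
\<close>

lemma strong_folding_step_translate:
  assumes step: "strong_folding_step G S I J J'" and J: "J \<subseteq> cosets" and g: "g \<in> carrier G"
  shows "strong_folding_step G S I (translate g J) (translate g J')"
proof -
  have J': "J' \<subseteq> cosets" using strong_folding_step_subset[OF step] .
  obtain t b where t: "t \<in> refls"
    and fold: "\<And>w. w \<in> carrier G \<Longrightarrow>
      coset w \<in> J' \<longleftrightarrow> coset (if moved b t w then t \<otimes> w else w) \<in> J"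
    and both: "\<And>c. \<exists>w\<in>carrier G. coset w \<in> J \<and> \<not> moved c t w"
    using step unfolding strong_folding_step_iff[OF J J'] by blast
  define t' where "t' = g \<otimes> t \<otimes> inv g"
  have t': "t' \<in> refls" using t g reflection_conj unfolding t'_def by blast
  \<comment> \<open>\<open>i\<close> records whether translation by \<open>g\<close> exchanges the
    left and the right side.\<close>
  define i where "i = inverts g t'"
  have ct: "conj_by g t' = t" using t g unfolding t'_def by (simp add: m_assoc)
  have moved: "moved (c \<noteq> i) t' (g \<otimes> w) \<longleftrightarrow> moved c t w" if "w \<in> carrier G" for w c
  proof -
    have "conj_by (g \<otimes> w) t' = conj_by w t"
      using conj_by_mult[of g w t'] ct that g t' by simp
    moreover have "inverts (g \<otimes> w) t' \<longleftrightarrow> i \<noteq> inverts w t"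
      using inverts_mult[of g w t'] ct that g t' unfolding i_def by simp
    ultimately show ?thesis unfolding moved_def by auto
  qed
  have "coset w \<in> translate g J' \<longleftrightarrow>
      coset (if moved (b \<noteq> i) t' w then t' \<otimes> w else w) \<in> translate g J"
    if w: "w \<in> carrier G" for w
  proof -
    define v where "v = inv g \<otimes> w"
    have v: "v \<in> carrier G" "w = g \<otimes> v" using g w by (simp_all add: v_def)
    have "inv g \<otimes> (t' \<otimes> w) = t \<otimes> v" and "inv g \<otimes> w = v"
      using g t v unfolding t'_def by (simp_all add: m_assoc)
    then show ?thesis
      using fold[OF v(1)] moved[OF v(1), of b] v g t' w J J'
      by (simp add: translate_mem_iff del: inv_mult_cancel)
  qed
  moreover have "\<exists>w\<in>carrier G. coset w \<in> translate g J \<and> \<not> moved c t' w" for c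
  proof -
    obtain w where w: "w \<in> carrier G" "coset w \<in> J" "\<not> moved (c \<noteq> i) t w"
      using both by blast
    moreover have "((c \<noteq> i) \<noteq> i) = c" by blast
    ultimately have "\<not> moved c t' (g \<otimes> w)"
      using moved[OF w(1), of "c \<noteq> i"] by simp
    moreover have "coset (g \<otimes> w) \<in> translate g J"
      using w g J by (simp add: translate_mem_iff)
    ultimately show ?thesis using w g by blast
  qed
  ultimately show ?thesis
    by (rule strong_folding_stepI[OF t' translate_subset[OF J g] translate_subset[OF J' g]])
qed

section \<open>Chains of strong folding steps\<close>

abbreviation reaches :: "'a set set \<Rightarrow> 'a set set \<Rightarrow> bool" where
  "reaches \<equiv> (strong_folding_step G S I)\<^sup>*\<^sup>*"

lemma reaches_translate:
  assumes "reaches J J'" "J \<subseteq> cosets" "g \<in> carrier G"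
  shows "reaches (translate g J) (translate g J')"
  using assms(1)
proof induction
  case (step K L)
  \<comment> \<open>\<open>K\<close> is either the initial set or the result of a step.\<close>
  have "K \<subseteq> cosets"
    using step(1) assms(2) by cases (auto dest: strong_folding_step_subset)
  with step assms(3) show ?case
    using strong_folding_step_translate by (meson rtranclp.rtrancl_into_rtrancl)
qed simp

lemma reaches_sequence:
  assumes "reaches J J'" "J \<subseteq> cosets"
  shows "\<exists>Js. finite_strong_folding_sequence G S I Js \<and> hd Js = J \<and> last Js = J'"
  using assms
proof (induction rule: converse_rtranclp_induct)
  case base
  then have "finite_strong_folding_sequence G S I [J']"
    by (simp add: finite_strong_folding_sequence_def)
  then show ?case by (metis last_ConsL list.sel(1))
next
  case (step J K)
  then obtain Js where Js: "finite_strong_folding_sequence G S I Js" "hd Js = K" "last Js = J'"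
    using strong_folding_step_subset by blast
  then have ne: "Js \<noteq> []" by (simp add: finite_strong_folding_sequence_def)
  then have "Js ! 0 = K" using Js(2) by (simp add: hd_conv_nth)
  then have "finite_strong_folding_sequence G S I (J # Js)"
    using Js(1) step unfolding finite_strong_folding_sequence_def
    by (auto simp: nth_Cons split: nat.split)
  with Js ne show ?case by (metis last_ConsR list.sel(1))
qed

section \<open>Maximal parabolic subgroups percolate\<close>

text \<open>For a reduced word this is the image in the coset space of the Bruhat interval below its
  product. Arbitrary words are allowed so that letters can be prepended until every group element
  occurs.\<close>

definition subword_cosets :: "'a list \<Rightarrow> 'a set set" where
  "subword_cosets ss = {coset (list_prod ys) | ys. subseq ys ss}"

lemma subseq_gens: "subseq ys ss \<Longrightarrow> ss \<in> lists S \<Longrightarrow> ys \<in> lists S"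
  by (induction rule: list_emb.induct) auto

lemma list_prod_gens_closed [simp]: "ss \<in> lists S \<Longrightarrow> list_prod ss \<in> carrier G"
  using list_prod_closed lists_gens_carrier by blast

lemma subword_cosets_subset: "ss \<in> lists S \<Longrightarrow> subword_cosets ss \<subseteq> cosets"
proof
  fix C
  assume "ss \<in> lists S" "C \<in> subword_cosets ss"
  then obtain ys where "ys \<in> lists S" "C = coset (list_prod ys)"
    unfolding subword_cosets_def using subseq_gens by blast
  then show "C \<in> cosets" by simp
qed

lemma one_in_subword_cosets: "coset \<one> \<in> subword_cosets ss"
  unfolding subword_cosets_def mem_Collect_eq by (rule exI[of _ "[]"]) simp

lemma subword_cosets_Cons_iff:
  assumes "ss \<in> lists S" "s \<in> S" "w \<in> carrier G"
  shows "coset w \<in> subword_cosets (s # ss) \<longleftrightarrow> coset w \<in> subword_cosets ss \<or> coset (s \<otimes> w) \<in> subword_cosets ss"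
proof
  assume "coset w \<in> subword_cosets (s # ss)"
  then obtain ys where ys: "coset w = coset (list_prod ys)" "subseq ys (s # ss)"
    unfolding subword_cosets_def by blast
  from ys(2) show "coset w \<in> subword_cosets ss \<or> coset (s \<otimes> w) \<in> subword_cosets ss"
  proof cases
    case (list_emb_Cons2 y zs)
    then have z: "list_prod zs \<in> carrier G" using subseq_gens assms(1) by simp
    have "coset (s \<otimes> w) = s <# coset w" using assms coset_mult by simp
    also have "\<dots> = coset (list_prod zs)"
      unfolding ys(1) using list_emb_Cons2 assms(2) z
      by (simp add: coset_mult reflection_cancel gen_reflection)
    finally show ?thesis using list_emb_Cons2 unfolding subword_cosets_def by blast
  next
    case list_emb_Nil
    then show ?thesis using ys(1) one_in_subword_cosets by simp
  next
    case list_emb_Cons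
    then show ?thesis using ys(1) unfolding subword_cosets_def by blast
  qed
next
  assume "coset w \<in> subword_cosets ss \<or> coset (s \<otimes> w) \<in> subword_cosets ss"
  then show "coset w \<in> subword_cosets (s # ss)"
  proof
    assume "coset w \<in> subword_cosets ss"
    then show ?thesis unfolding subword_cosets_def by blast
  next
    assume "coset (s \<otimes> w) \<in> subword_cosets ss"
    then obtain ys where ys: "coset (s \<otimes> w) = coset (list_prod ys)" "subseq ys ss"
      unfolding subword_cosets_def by blast
    then have "s <# coset (s \<otimes> w) = coset (list_prod (s # ys))"
      using assms subseq_gens by (simp add: coset_mult)
    then have "coset w = coset (list_prod (s # ys))"
      using assms gen_reflection by (simp add: coset_mult)
    then show ?thesis using ys(2) unfolding subword_cosets_def by blast
  qed
qed

text \<open>By strong exchange the subword products form a lower set in the Bruhat order.\<close>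

lemma subword_cosets_reflection:
  assumes ss: "ss \<in> lists S" and t: "t \<in> refls" and w: "w \<in> carrier G"
    and "coset w \<in> subword_cosets ss" "moved True t w"
  shows "coset (t \<otimes> w) \<in> subword_cosets ss"
proof -
  obtain ys where ys: "coset w = coset (list_prod ys)" "subseq ys ss"
    using assms unfolding subword_cosets_def by blast
  have yS: "ys \<in> lists S" using ys ss subseq_gens by blast
  then have "moved True t (list_prod ys)" using moved_cong[OF w _ t ys(1)] assms by simp
  then have "inversion_parity ys t"
    using inverts_list_prod yS t unfolding moved_def by simp
  from strong_exchange[OF yS _ this] t obtain us s vs
    where e: "ys = us @ s # vs" "t \<otimes> list_prod ys = list_prod (us @ vs)" by auto
  have "coset (t \<otimes> w) = t <# coset w" using t w coset_mult by simp
  also have "\<dots> = coset (list_prod (us @ vs))"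
    unfolding ys(1) using e(2) t yS by (simp add: coset_mult)
  finally have "coset (t \<otimes> w) = coset (list_prod (us @ vs))" .
  moreover have "subseq (us @ vs) ss"
    using ys(2) unfolding e(1)
    by (meson list_emb_Cons list_emb_append_mono subseq_order.dual_order.trans subseq_order.order_refl)
  ultimately show ?thesis unfolding subword_cosets_def by blast
qed

lemma subword_cosets_step:
  assumes ss: "ss \<in> lists S" and s: "s \<in> S"
    and gens: "\<And>r. r \<in> S - I \<Longrightarrow> r \<in> set ss"
  shows "strong_folding_step G S I (subword_cosets ss) (subword_cosets (s # ss))"
proof -
  have t: "s \<in> refls" using s gen_reflection by blast
  have sss: "s # ss \<in> lists S" using ss s by simp
  have "coset w \<in> subword_cosets (s # ss) \<longleftrightarrow> coset (if moved True s w then s \<otimes> w else w) \<in> subword_cosets ss"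
    if w: "w \<in> carrier G" for w
  proof (cases "moved True s w")
    case True
    then show ?thesis using subword_cosets_Cons_iff[OF ss s w] subword_cosets_reflection[OF ss t w _ True] by auto
  next
    case False
    \<comment> \<open>Here \<open>wW\<^sub>I\<close> is the lower coset of the two, or both
      coincide.\<close>
    have "coset w \<in> subword_cosets ss" if l: "coset (s \<otimes> w) \<in> subword_cosets ss"
    proof (cases "moved False s w")
      case True
      then have "moved True s (s \<otimes> w)" using moved_reflection_mult t w by simp
      from subword_cosets_reflection[OF ss t _ l this] show ?thesis using s t w by simp
    next
      case False
      then have "conj_by w s \<in> parabolic" using \<open>\<not> moved True s w\<close> unfolding moved_def by blast
      then have "coset (s \<otimes> w) = coset w" using coset_reflection_fixed[OF t w] by blast
      with l show ?thesis by simp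
    qed
    then show ?thesis using subword_cosets_Cons_iff[OF ss s w] False by auto
  qed
  moreover have "\<exists>w\<in>carrier G. coset w \<in> subword_cosets ss \<and> \<not> moved c s w" for c
  \<comment> \<open>\<open>W\<^sub>I\<close> is left of or fixed by \<open>s\<close>. If
    \<open>s\<close> lies outside \<open>I\<close>, the witness on the right is
    \<open>sW\<^sub>I\<close>, present because \<open>s\<close> is a letter of
    \<open>ss\<close>.\<close>
  proof (cases "c \<or> s \<in> I")
    case True
    then have "\<not> moved c s \<one>"
      using s unfolding moved_def by (auto intro: generate.incl)
    then show ?thesis using one_in_subword_cosets by blast
  next
    case False
    then have "subseq [s] ss" using gens s subseq_singleton_left by fastforce
    then have "coset (list_prod [s]) \<in> subword_cosets ss" unfolding subword_cosets_def by blast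
    then have "coset s \<in> subword_cosets ss" using s by simp
    moreover have "\<not> moved c s s"
      using False s inverts_gen unfolding moved_def by simp
    ultimately show ?thesis using gen_carrier[OF s] by (intro bexI[of _ s] conjI)
  qed
  ultimately show ?thesis
    by (rule strong_folding_stepI[OF t subword_cosets_subset[OF ss] subword_cosets_subset[OF sss]])
qed

lemma reaches_subword_cosets:
  assumes "rs \<in> lists S" "ss \<in> lists S" "\<And>r. r \<in> S - I \<Longrightarrow> r \<in> set ss"
  shows "reaches (subword_cosets ss) (subword_cosets (rs @ ss))"
  using assms(1)
proof (induction rs)
  case (Cons s rs)
  then have "strong_folding_step G S I (subword_cosets (rs @ ss)) (subword_cosets (s # rs @ ss))"
    using assms by (intro subword_cosets_step) auto
  with Cons show ?case by auto
qed simp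

text \<open>Concatenate words for the elements of \<open>A\<close>; each survives as a subword. For
  finite \<open>W\<close> this gives one word whose subword products are all of
  \<open>W\<close>.\<close>

lemma word_with_subwords:
  assumes "finite A" "A \<subseteq> carrier G"
  shows "\<exists>rs\<in>lists S. \<forall>a\<in>A. \<exists>ys. subseq ys rs \<and> list_prod ys = a"
  using assms
proof induction
  case (insert a A)
  then obtain rs where rs: "rs \<in> lists S" "\<forall>a\<in>A. \<exists>ys. subseq ys rs \<and> list_prod ys = a"
    by auto
  obtain as where as: "as \<in> lists S" "list_prod as = a"
    using obtain_word insert by blast
  have "subseq as (as @ rs)" by (simp add: subseq_rev_drop_many)
  moreover have "\<exists>ys. subseq ys (as @ rs) \<and> list_prod ys = b" if "b \<in> A" for b
    using rs(2) that subseq_drop_many[of _ rs as] by blast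
  ultimately have "\<forall>b\<in>insert a A. \<exists>ys. subseq ys (as @ rs) \<and> list_prod ys = b"
    using as(2) by blast
  moreover have "as @ rs \<in> lists S" using rs as by auto
  ultimately show ?case by blast
qed auto

text \<open>The subwords of \<open>[s]\<close> give the starting pair, and \<open>[s]\<close>
  already contains every generator outside \<open>I\<close>, so any letters may be
  prepended.\<close>

lemma reaches_all_from_gen:
  assumes s: "s \<in> S" "S - I = {s}"
  shows "reaches {coset \<one>, coset s} cosets"
proof -
  obtain rs where rs: "rs \<in> lists S" "\<forall>a\<in>carrier G. \<exists>ys. subseq ys rs \<and> list_prod ys = a"
    using word_with_subwords[OF finite_carrier] by blast
  have "reaches (subword_cosets [s]) (subword_cosets (rs @ [s]))"
    using s rs by (intro reaches_subword_cosets) auto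
  moreover have "{ys. subseq ys [s]} = {[], [s]}"
    by (simp flip: set_subseqs_eq add: insert_commute)
  then have "subword_cosets [s] = {coset \<one>, coset s}"
    unfolding subword_cosets_def setcompr_eq_image using s by simp
  moreover have "subword_cosets (rs @ [s]) = cosets"
  proof (rule cosets_eqI)
    show "subword_cosets (rs @ [s]) \<subseteq> cosets" using rs s by (intro subword_cosets_subset) auto
    fix w
    assume w: "w \<in> carrier G"
    then obtain ys where "subseq ys (rs @ [s])" "list_prod ys = w"
      using rs subseq_rev_drop_many by blast
    then show "coset w \<in> subword_cosets (rs @ [s]) \<longleftrightarrow> coset w \<in> cosets"
      using w unfolding subword_cosets_def by auto
  qed simp
  ultimately show ?thesis by simp
qed

text \<open>
  With \<open>usv\<close> a reduced word of the minimal representative, \<open>u\<close> in \<open>W\<^sub>I\<close> and \<open>s\<close> outside \<open>I\<close>, the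
  reflection \<open>usu\<inverse>\<close> separates the two cosets, and folding along it yields a translate of
  \<open>{W\<^sub>I, sW\<^sub>I}\<close>.
\<close>

lemma reaches_all:
  assumes s: "s \<in> S" "S - I = {s}" and w: "w \<in> carrier G" "w \<notin> parabolic"
  shows "reaches {parabolic, coset w} cosets"
proof -
  define x where "x = min_rep G S I w"
  have x: "x \<in> coset w" "x \<in> carrier G"
    using min_rep_in_coset[OF w(1)] coset_carrier w unfolding x_def by blast+
  have cx: "coset x = coset w" using x w mem_coset_iff coset_eq_iff by blast
  have min: "len x \<le> len v" if "v \<in> coset x" for v
    using min_rep_le[OF w(1)] that cx unfolding x_def by simp
  have xnp: "x \<notin> parabolic"
    using cx w coset_one coset_eq_iff[of \<one> x] coset_eq_iff[of \<one> w] x by simp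
  obtain ss where ss: "ss \<in> lists S" "list_prod ss = x" "length ss = len x"
    using obtain_reduced_word x by blast
  have "\<not> set ss \<subseteq> I"
    using xnp ss generate_list_prod[OF subset_gens] by auto
  then have "s \<in> set ss" using s ss by auto
  \<comment> \<open>Splitting at the first \<open>s\<close> leaves a prefix over \<open>I\<close>,
    because \<open>s\<close> is the only generator outside \<open>I\<close>.\<close>
  then obtain us vs where e: "ss = us @ s # vs" "s \<notin> set us"
    using split_list_first by metis
  have us: "us \<in> lists I" "us \<in> lists S" and vs: "vs \<in> lists S"
    using e ss s by auto
  define u where "u = list_prod us"
  have u: "u \<in> parabolic" "u \<in> carrier G"
    using us generate_list_prod[OF subset_gens] unfolding u_def by auto
  have sc: "s \<in> carrier G" and snp: "s \<notin> parabolic"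
    using s gen_in_parabolic_iff by auto
  define t where "t = u \<otimes> s \<otimes> inv u"
  have t: "t \<in> refls" unfolding t_def reflections_def using u s by blast
  have tc: "t \<in> carrier G" using t by simp
  have tnp: "t \<notin> parabolic"
    using snp u sc parabolic_mult_left_iff[of u "s \<otimes> inv u"]
      parabolic_mult_right_iff[of "inv u" s] unfolding t_def by (simp add: m_assoc)
  have "t \<otimes> x = list_prod (us @ vs)"
    unfolding t_def u_def ss(2)[symmetric] e(1)
    by (rule list_prod_delete) (use us vs s in \<open>simp_all add: lists_gens_carrier del: in_lists_conv_set\<close>)
  moreover have "us @ vs \<in> lists S" using us vs by simp
  ultimately have less: "len (t \<otimes> x) < len x"
    using len_list_prod_le[of "us @ vs"] ss(3) e(1) by simp
  \<comment> \<open>\<open>tx\<close> is shorter than the minimal \<open>x\<close>, hence lies in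
    another coset.\<close>
  have "conj_by x t \<notin> parabolic"
    using min[of "t \<otimes> x"] less x t by (auto simp: mem_coset_iff m_assoc)
  then have mx: "moved True t x"
    using less len_reflection_less_iff x t unfolding moved_def by blast
  have m1: "\<not> moved True t \<one>" "moved False t \<one>"
    using tnp tc unfolding moved_def by simp_all
  have tu: "coset t = coset (u \<otimes> s)"
    using coset_parabolic_mult[of "u \<otimes> s" "inv u"] u sc unfolding t_def by simp
  have J: "{coset \<one>, coset x} \<subseteq> cosets" using x by simp
  have J': "{coset \<one>, coset t} \<subseteq> cosets" using tc by simp
  have "coset v \<in> {coset \<one>, coset t} \<longleftrightarrow>
      coset (if moved True t v then t \<otimes> v else v) \<in> {coset \<one>, coset x}"
    if v: "v \<in> carrier G" for v
  \<comment> \<open>A moved coset is sent to the left side, where only \<open>W\<^sub>I\<close> of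
    the pair lies, so it must be \<open>tW\<^sub>I\<close>. An unmoved coset stays put and can only
    be \<open>W\<^sub>I\<close>, since \<open>xW\<^sub>I\<close> is moved.\<close>
  proof (cases "moved True t v")
    case True
    then have "coset v \<noteq> coset \<one>" using m1 moved_cong v t by blast
    moreover have "coset (t \<otimes> v) \<noteq> coset x"
      using True mx moved_cong[of "t \<otimes> v" x t True] moved_reflection_mult[of t v True] v t x
      by (auto simp: moved_def)
    moreover have "coset (t \<otimes> v) = coset \<one> \<longleftrightarrow> coset v = coset t"
    proof
      assume "coset (t \<otimes> v) = coset \<one>"
      then have "t <# coset (t \<otimes> v) = t <# coset \<one>" by simp
      then show "coset v = coset t" using v t tc by (simp add: coset_mult)
    next
      assume "coset v = coset t"
      then have "t <# coset v = t <# coset t" by simp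
      then show "coset (t \<otimes> v) = coset \<one>" using v t tc by (simp add: coset_mult)
    qed
    ultimately show ?thesis using True by auto
  next
    case False
    have "coset v \<noteq> coset x" using False mx moved_cong v x t by blast
    moreover have "moved True t t"
      using m1 moved_reflection_mult[of t \<one> True] t tc by simp
    then have "coset v \<noteq> coset t" using False moved_cong v t tc by blast
    ultimately show ?thesis using False by auto
  qed
  moreover have "\<exists>v\<in>carrier G. coset v \<in> {coset \<one>, coset x} \<and> \<not> moved c t v" for c
  proof (cases c)
    case True
    then show ?thesis using m1 by auto
  next
    case False
    then have "\<not> moved c t x" using mx unfolding moved_def by simp
    then show ?thesis using x by blast
  qed
  ultimately have "strong_folding_step G S I {coset \<one>, coset x} {coset \<one>, coset t}"
    by (rule strong_folding_stepI[OF t J J'])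
  \<comment> \<open>\<open>u\<close> lies in \<open>W\<^sub>I\<close>, so translation by
    \<open>u\<close> fixes \<open>W\<^sub>I\<close> and sends \<open>sW\<^sub>I\<close> to
    \<open>usW\<^sub>I\<close>, which equals \<open>tW\<^sub>I\<close>.\<close>
  moreover have "{coset \<one>, coset t} = translate u {coset \<one>, coset s}"
    using tu u sc coset_parabolic_mult[of \<one> u] by (simp add: coset_mult)
  moreover have "reaches (translate u {coset \<one>, coset s}) (translate u cosets)"
    using reaches_all_from_gen[OF s] u sc by (intro reaches_translate) auto
  ultimately show ?thesis
    using u translate_cosets cx coset_one by (simp add: converse_rtranclp_into_rtranclp)
qed

lemma strongly_percolates_maximal:
  assumes "s \<in> S" "S - I = {s}"
  shows "strongly_percolates G S I"
  unfolding strongly_percolates_def strong_percolating_sequence_def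
proof
  fix w
  assume "w \<in> carrier G - parabolic"
  moreover from this have "{parabolic, coset w} \<subseteq> cosets"
    using coset_in_cosets[of \<one>] coset_one by auto
  ultimately show "\<exists>Js. finite_strong_folding_sequence G S I Js \<and>
      hd Js = {parabolic, coset w} \<and> last Js = cosets"
    using reaches_all[OF assms] reaches_sequence by blast
qed

section \<open>Non-maximal parabolic subgroups do not percolate\<close>

text \<open>For \<open>t\<close> outside \<open>W\<^sub>K\<close>, no \<open>v\<close> in
  \<open>W\<^sub>K\<close> inverts \<open>t\<close> and \<open>v^-1 t v\<close> stays outside
  \<open>W\<^sub>K\<close>, so all of \<open>J\<close> is strictly left, against the meeting
  condition. Hence \<open>t\<close> lies in \<open>W\<^sub>K\<close>, and multiplying by it
  preserves \<open>W\<^sub>K\<close>.\<close>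

lemma strong_folding_step_confined:
  assumes K: "I \<subseteq> K" "K \<subseteq> S"
    and step: "strong_folding_step G S I J J'" and J: "J \<subseteq> cosets"
    and conf: "\<And>w. w \<in> carrier G \<Longrightarrow> coset w \<in> J \<Longrightarrow> w \<in> generate G K"
    and w: "w \<in> carrier G" "coset w \<in> J'"
  shows "w \<in> generate G K"
proof -
  interpret K: coxeter_parabolic G S m K
    by unfold_locales (rule K)
  have J': "J' \<subseteq> cosets" using strong_folding_step_subset[OF step] .
  obtain t b where t: "t \<in> refls"
    and fold: "\<And>w. w \<in> carrier G \<Longrightarrow>
      coset w \<in> J' \<longleftrightarrow> coset (if moved b t w then t \<otimes> w else w) \<in> J"
    and both: "\<And>c. \<exists>w\<in>carrier G. coset w \<in> J \<and> \<not> moved c t w"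
    using step unfolding strong_folding_step_iff[OF J J'] by blast
  have tK: "t \<in> generate G K"
  proof (rule ccontr)
    assume nt: "t \<notin> generate G K"
    have "moved False t v" if v: "v \<in> carrier G" "coset v \<in> J" for v
    proof -
      have vK: "v \<in> generate G K" using conf v by blast
      have "\<not> inverts v t" using K.parabolic_inverts[OF vK] t nt by auto
      moreover have "conj_by v t \<notin> generate G K"
        using nt vK v t K.parabolic_mult_left_iff[of "inv v" "t \<otimes> v"]
          K.parabolic_mult_right_iff[of v t] by (simp add: m_assoc)
      then have "conj_by v t \<notin> parabolic"
        using mono_generate[OF K(1)] by blast
      ultimately show ?thesis unfolding moved_def by blast
    qed
    with both show False by blast
  qed
  have "t \<otimes> w \<in> generate G K \<or> w \<in> generate G K"
    using fold[OF w(1)] w conf t by (auto split: if_splits)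
  then show ?thesis
    using K.parabolic_mult_left_iff[OF tK w(1)] by blast
qed

text \<open>Confinement to \<open>W\<^sub>K\<close> propagates along the sequence by induction, but
  the final set would have to contain \<open>s'W\<^sub>I\<close> with \<open>s'\<close> outside
  \<open>K\<close>.\<close>

lemma not_strongly_percolates:
  assumes "s \<in> S - I" "s' \<in> S - I" "s \<noteq> s'"
  shows "\<not> strongly_percolates G S I"
proof
  assume "strongly_percolates G S I"
  define K where "K = insert s I"
  have K: "I \<subseteq> K" "K \<subseteq> S" using assms subset_gens by (auto simp: K_def)
  interpret K: coxeter_parabolic G S m K
    by unfold_locales (rule K)
  have sK: "s \<in> generate G K" by (auto simp: K_def intro: generate.incl)
  have "s \<in> carrier G - parabolic" using assms gen_in_parabolic_iff by auto
  then obtain Js where Js: "finite_strong_folding_sequence G S I Js"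
    "hd Js = {parabolic, coset s}" "last Js = cosets"
    using \<open>strongly_percolates G S I\<close>
    unfolding strongly_percolates_def strong_percolating_sequence_def by blast
  have ne: "Js \<noteq> []" using Js by (simp add: finite_strong_folding_sequence_def)
  have conf: "\<forall>w\<in>carrier G. coset w \<in> Js ! i \<longrightarrow> w \<in> generate G K" if "i < length Js" for i
    using that
  proof (induction i)
    case 0
    have "w \<in> generate G K" if w: "w \<in> carrier G" "coset w = coset \<one> \<or> coset w = coset s" for w
    proof -
      have "w \<in> parabolic \<or> inv s \<otimes> w \<in> parabolic"
        using w assms coset_eq_iff[of \<one> w] coset_eq_iff[of s w] by auto
      then have "w \<in> generate G K \<or> inv s \<otimes> w \<in> generate G K"
        using mono_generate[OF K(1)] by blast
      then show ?thesis
        using K.parabolic_mult_left_iff[of "inv s" w] sK w K.parabolic_inv by blast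
    qed
    then show ?case using Js(2) ne coset_one by (auto simp: hd_conv_nth)
  next
    case (Suc i)
    have "strong_folding_step G S I (Js ! i) (Js ! Suc i)" "Js ! i \<subseteq> cosets"
      using Js(1) Suc.prems by (auto simp: finite_strong_folding_sequence_def)
    with Suc show ?case
      using strong_folding_step_confined[OF K] by (metis Suc_lessD)
  qed
  have "s' \<in> generate G K"
    using conf[of "length Js - 1"] ne Js(3) assms by (simp add: last_conv_nth)
  then have "s' \<in> K" using K.gen_in_parabolic_iff assms by blast
  then show False using assms by (auto simp: K_def)
qed

end

theorem theorem3p11:
  fixes G :: "('a, 'b) monoid_scheme" (structure)
    and S I :: "'a set"
    and m :: "'a \<Rightarrow> 'a \<Rightarrow> nat"
  assumes "finite_coxeter_system G S m"
    and "I \<subset> S"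
  shows "strongly_percolates G S I \<longleftrightarrow> card I = card S - 1"
proof -
  interpret finite_coxeter_system G S m by fact
  interpret coxeter_parabolic G S m I
    by unfold_locales (use assms(2) in blast)
  have fin: "finite S" using gens_carrier finite_carrier finite_subset by blast
  have "card S = card I + card (S - I)"
    using fin assms(2) by (metis card_mono card_Diff_subset finite_subset le_add_diff_inverse psubset_imp_subset)
  moreover have "S - I \<noteq> {}" using assms(2) by blast
  \<comment> \<open>\<open>S - I\<close> is nonempty, so \<open>card S\<close> is positive and the
    truncated subtraction is exact.\<close>
  ultimately have card: "card I = card S - 1 \<longleftrightarrow> card (S - I) = 1"
    using fin card_gt_0_iff[of "S - I"] by auto
  show ?thesis
  proof (cases "card (S - I) = 1")
    case True
    then obtain s where "S - I = {s}" using card_1_singletonE by blast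
    then show ?thesis using strongly_percolates_maximal[of s] True card by auto
  next
    case False
    then obtain s s' where "s \<in> S - I" "s' \<in> S - I" "s \<noteq> s'"
      using \<open>S - I \<noteq> {}\<close> fin by (metis finite_Diff is_singletonI' is_singleton_altdef)
    then show ?thesis using not_strongly_percolates False card by blast
  qed
qed

end
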